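(* Let $S$ be a $(2,\omega)$-divisible Cu-semigroup satisfying (O5), (O6), (O7), and let $e\in S$ be full. Then there exists $w\in S_{\mathrm{soft}}$ such that $w\le e\le\infty w$, $\lambda(w)=\lambda(e)$ for all $\lambda\in F(S)$, and $\mathrm{rc}(S,e)=\mathrm{rc}(S_{\mathrm{soft}},w)$. If $S$ is moreover countably based and left-soft separative, then $\mathrm{rc}(S,e)=\mathrm{rc}(S_{\mathrm{soft}},\sigma(e))$, where $\sigma(e)$ is the largest strongly soft element below $e$.
   Context: A Cu-semigroup is a positively ordered commutative monoid satisfying (O1)–(O4): increasing sequences have suprema; each element is the supremum of a $\ll$-increasing sequence; $x'\ll x,y'\ll y\Rightarrow x'+y'\ll x+y$; suprema of increasing sequences are additive. $x\ll y$: whenever $y\le\sup z_n$ for increasing $(z_n)$, $x\le z_m$ for some $m$. (O5): if $x+y\le z$, $x'\ll x$, $y'\ll y$ then some $c$ has $y'\ll c$, $x'+c\le z\le x+c$. (O6): if $x'\ll x\le y+z$ then some $v,w$ have $v\le x,y$, $w\le x,z$, $x'\le v+w$. (O7): if $x'\ll x\le w$, $y'\ll y\le w$ then some $z$ has $x',y'\ll z\le w,x+y$. $\infty x=\sup nx$; $e$ is full if $\infty e$ is the largest element of $S$. Strongly soft: for each $x'\ll x$ there is $t$ with $x'+t\ll x$, $x'\ll\infty t$; $S_{\mathrm{soft}}$ = strongly soft elements, which here is a sub-Cu-semigroup. $(2,\omega)$-divisible: for $x'\ll x$ there is $y$ with $2y\le x$, $x'\le\infty y$. Countably based: some countable subset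 has every element as supremum of an increasing sequence from it. Left-soft separative: $y,t$ and $x\in S_{\mathrm{soft}}$ with $x+t\ll y+t$, $t\ll\infty x,\infty y$ imply $x\ll y$. $F(T)$: monoid morphisms $T\to[0,\infty]$ preserving order and suprema of increasing sequences. For a Cu-semigroup $T$, full $e\in T$ and $r>0$, $(T,e)$ satisfies (R1) for $r$ if for all $x,y\in T$, $\lambda(x)+r\lambda(e)\le\lambda(y)$ for all $\lambda\in F(T)$ implies $x\le y$; $\mathrm{rc}(T,e)$ is the infimum of all $r>0$ for which (R1) holds. *)

theory Defs
  imports Complex_Main "HOL-Library.Extended_Nonnegative_Real" "HOL-Library.Countable_Set"
begin

text \<open>Cu-semigroups are modelled on a type 'a of class ordered_comm_monoid_add
(partial order, commutative monoid, addition monotone).  Notions that must be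
evaluated in a sub-semigroup (suprema, way-below, infinite multiples, F(T), rc)
are defined relative to a carrier set T, with the induced order and addition;
for the ambient semigroup S we use T = UNIV.\<close>

primrec nmul :: "nat \<Rightarrow> 'a::monoid_add \<Rightarrow> 'a" where
  "nmul 0 x = 0"
| "nmul (Suc n) x = x + nmul n x"

definition lub_in :: "'a::order set \<Rightarrow> (nat \<Rightarrow> 'a) \<Rightarrow> 'a \<Rightarrow> bool" where
  "lub_in T f s \<longleftrightarrow> s \<in> T \<and> (\<forall>n. f n \<le> s) \<and> (\<forall>y\<in>T. (\<forall>n. f n \<le> y) \<longrightarrow> s \<le> y)"

definition incseq_in :: "'a::order set \<Rightarrow> (nat \<Rightarrow> 'a) \<Rightarrow> bool" where
  "incseq_in T f \<longleftrightarrow> (\<forall>n. f n \<in> T) \<and> (\<forall>n. f n \<le> f (Suc n))"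

definition wb_in :: "'a::order set \<Rightarrow> 'a \<Rightarrow> 'a \<Rightarrow> bool" where
  "wb_in T x y \<longleftrightarrow>
     (\<forall>f s. incseq_in T f \<and> lub_in T f s \<and> y \<le> s \<longrightarrow> (\<exists>m. x \<le> f m))"

definition infty_in :: "'a::ordered_comm_monoid_add set \<Rightarrow> 'a \<Rightarrow> 'a" where
  "infty_in T x = (THE s. lub_in T (\<lambda>n. nmul n x) s)"

definition cu_semigroup :: "'a::ordered_comm_monoid_add set \<Rightarrow> bool" where
  "cu_semigroup T \<longleftrightarrow>
     0 \<in> T \<and> (\<forall>x\<in>T. \<forall>y\<in>T. x + y \<in> T) \<and> (\<forall>x\<in>T. 0 \<le> x)
   \<and> (\<comment> \<open>O1\<close> \<forall>f. incseq_in T f \<longrightarrow> (\<exists>s. lub_in T f s))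
   \<and> (\<comment> \<open>O2\<close> \<forall>x\<in>T. \<exists>f. (\<forall>n. f n \<in> T) \<and> (\<forall>n. wb_in T (f n) (f (Suc n))) \<and> lub_in T f x)
   \<and> (\<comment> \<open>O3\<close> \<forall>x'\<in>T. \<forall>x\<in>T. \<forall>y'\<in>T. \<forall>y\<in>T.
          wb_in T x' x \<and> wb_in T y' y \<longrightarrow> wb_in T (x' + y') (x + y))
   \<and> (\<comment> \<open>O4\<close> \<forall>f g x y. incseq_in T f \<and> incseq_in T g \<and> lub_in T f x \<and> lub_in T g y
          \<longrightarrow> lub_in T (\<lambda>n. f n + g n) (x + y))"

definition O5 :: "'a::ordered_comm_monoid_add set \<Rightarrow> bool" where
  "O5 T \<longleftrightarrow> (\<forall>x\<in>T. \<forall>y\<in>T. \<forall>z\<in>T. \<forall>x'\<in>T. \<forall>y'\<in>T.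
     x + y \<le> z \<and> wb_in T x' x \<and> wb_in T y' y \<longrightarrow>
     (\<exists>c\<in>T. wb_in T y' c \<and> x' + c \<le> z \<and> z \<le> x + c))"

definition O6 :: "'a::ordered_comm_monoid_add set \<Rightarrow> bool" where
  "O6 T \<longleftrightarrow> (\<forall>x'\<in>T. \<forall>x\<in>T. \<forall>y\<in>T. \<forall>z\<in>T.
     wb_in T x' x \<and> x \<le> y + z \<longrightarrow>
     (\<exists>v\<in>T. \<exists>w\<in>T. v \<le> x \<and> v \<le> y \<and> w \<le> x \<and> w \<le> z \<and> x' \<le> v + w))"

definition O7 :: "'a::ordered_comm_monoid_add set \<Rightarrow> bool" where
  "O7 T \<longleftrightarrow> (\<forall>x'\<in>T. \<forall>x\<in>T. \<forall>y'\<in>T. \<forall>y\<in>T. \<forall>w\<in>T.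
     wb_in T x' x \<and> x \<le> w \<and> wb_in T y' y \<and> y \<le> w \<longrightarrow>
     (\<exists>z\<in>T. wb_in T x' z \<and> wb_in T y' z \<and> z \<le> w \<and> z \<le> x + y))"

definition two_omega_divisible :: "'a::ordered_comm_monoid_add set \<Rightarrow> bool" where
  "two_omega_divisible T \<longleftrightarrow> (\<forall>x'\<in>T. \<forall>x\<in>T. wb_in T x' x \<longrightarrow>
     (\<exists>y\<in>T. y + y \<le> x \<and> x' \<le> infty_in T y))"

definition full_in :: "'a::ordered_comm_monoid_add set \<Rightarrow> 'a \<Rightarrow> bool" where
  "full_in T e \<longleftrightarrow> e \<in> T \<and> (\<forall>x\<in>T. x \<le> infty_in T e)"

definition strongly_soft_in :: "'a::ordered_comm_monoid_add set \<Rightarrow> 'a \<Rightarrow> bool" where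
  "strongly_soft_in T x \<longleftrightarrow> x \<in> T \<and> (\<forall>x'\<in>T. wb_in T x' x \<longrightarrow>
     (\<exists>t\<in>T. wb_in T (x' + t) x \<and> wb_in T x' (infty_in T t)))"

definition soft_part :: "'a::ordered_comm_monoid_add set \<Rightarrow> 'a set" where
  "soft_part T = {x. strongly_soft_in T x}"

definition countably_based :: "'a::ordered_comm_monoid_add set \<Rightarrow> bool" where
  "countably_based T \<longleftrightarrow> (\<exists>B. B \<subseteq> T \<and> countable B \<and>
     (\<forall>x\<in>T. \<exists>f. (\<forall>n. f n \<in> B) \<and> incseq_in T f \<and> lub_in T f x))"

definition left_soft_separative :: "'a::ordered_comm_monoid_add set \<Rightarrow> bool" where
  "left_soft_separative T \<longleftrightarrow> (\<forall>x\<in>soft_part T. \<forall>y\<in>T. \<forall>t\<in>T.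
     wb_in T (x + t) (y + t) \<and> wb_in T t (infty_in T x) \<and> wb_in T t (infty_in T y)
     \<longrightarrow> wb_in T x y)"

definition functionals :: "'a::ordered_comm_monoid_add set \<Rightarrow> ('a \<Rightarrow> ennreal) set" where
  "functionals T = {l. l 0 = 0
     \<and> (\<forall>x\<in>T. \<forall>y\<in>T. l (x + y) = l x + l y)
     \<and> (\<forall>x\<in>T. \<forall>y\<in>T. x \<le> y \<longrightarrow> l x \<le> l y)
     \<and> (\<forall>f s. incseq_in T f \<and> lub_in T f s \<longrightarrow> l s = (SUP n. l (f n)))}"

definition R1 :: "'a::ordered_comm_monoid_add set \<Rightarrow> 'a \<Rightarrow> real \<Rightarrow> bool" where
  "R1 T e r \<longleftrightarrow> (\<forall>x\<in>T. \<forall>y\<in>T.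
     (\<forall>l\<in>functionals T. l x + ennreal r * l e \<le> l y) \<longrightarrow> x \<le> y)"

text \<open>rc(T,e) as an element of [0,\<infinity>]; the infimum of the empty set is \<infinity>.\<close>
definition rc :: "'a::ordered_comm_monoid_add set \<Rightarrow> 'a \<Rightarrow> ennreal" where
  "rc T e = Inf {ennreal r | r. 0 < r \<and> R1 T e r}"

end

theory Submission
  imports Defs
begin

text \<open>
  Every \<open>x\<close> contains a strongly soft \<open>w\<close> such that each \<open>x' \<lless> x\<close> satisfies \<open>x' \<le> w + v\<close> with \<open>v\<close>
  as small as desired relative to \<open>w\<close>. It is the supremum of elements obtained by removing ever
  smaller full pieces from \<open>x\<close> with O5; O6 and O7 are used to leave enough room for the next
  removal. Such a \<open>w\<close> cannot be distinguished from \<open>x\<close> by functionals, and it determines the only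
  possible value at \<open>x\<close> of an extension of a functional on the soft part. Hence
  \<open>F(S) = F(S_soft)\<close>. If \<open>v\<close> is soft and full with \<open>n v \<le> e\<close>, then \<open>x + v\<close> is soft, and so the
  comparison of \<open>x\<close> and \<open>y\<close> in \<open>S\<close> reduces to that of \<open>x + v\<close> with a soft replica of \<open>y\<close> at the cost of
  increasing \<open>r\<close> by \<open>1/n\<close>.

  For the second part, any two soft elements \<open>a, b \<le> e\<close> are approximately below the complement in
  \<open>e\<close> of a piece that is small in both \<open>a\<close> and \<open>b\<close>: separativity cancels this piece. Hence the
  soft elements below \<open>e\<close> are directed in the way-below sense.
\<close>

section \<open>Way-below relation and strongly soft elements\<close>

lemma nmul_add_distrib: "nmul n (x + y) = nmul n x + nmul n (y::'a::comm_monoid_add)"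
  by (induction n) (simp_all add: ac_simps)

lemma nmul_add: "nmul (m + n) x = nmul m x + nmul n (x::'a::comm_monoid_add)"
  by (induction m) (simp_all add: ac_simps)

lemma nmul_mult: "nmul (m * n) x = nmul m (nmul n (x::'a::comm_monoid_add))"
  by (induction m) (simp_all add: nmul_add)

lemma nmul_mono: "x \<le> y \<Longrightarrow> nmul n x \<le> nmul n (y::'a::ordered_comm_monoid_add)"
  by (induction n) (simp_all add: add_mono)

locale cu_sgrp =
  fixes wb :: "'a::ordered_comm_monoid_add \<Rightarrow> 'a \<Rightarrow> bool" (infix "\<lless>" 50)
    and infty :: "'a \<Rightarrow> 'a"
  assumes wb_eq: "wb = wb_in UNIV" and infty_eq: "infty = infty_in UNIV"
    and cu: "cu_semigroup (UNIV :: 'a set)"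
begin

abbreviation lub :: "(nat \<Rightarrow> 'a) \<Rightarrow> 'a \<Rightarrow> bool" where
  "lub \<equiv> lub_in UNIV"

lemma zero_least [simp]: "0 \<le> (x::'a)"
  using cu by (simp add: cu_semigroup_def)

lemma le_add_right: "(x::'a) \<le> x + y"
  using add_left_mono[of 0 y x] by simp

lemma le_add_left: "(x::'a) \<le> y + x"
  using le_add_right[of x y] by (simp add: add.commute)

lemma incseq_in_UNIV: "incseq_in UNIV f \<longleftrightarrow> incseq (f :: nat \<Rightarrow> 'a)"
  by (simp add: incseq_in_def incseq_Suc_iff)

lemma lub_ex: "incseq f \<Longrightarrow> \<exists>s. lub f s"
  using cu by (simp add: cu_semigroup_def incseq_in_UNIV)

lemma lub_upper: "lub f s \<Longrightarrow> f n \<le> s"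
  by (simp add: lub_in_def)

lemma lub_least: "lub f s \<Longrightarrow> (\<And>n. f n \<le> y) \<Longrightarrow> s \<le> y"
  by (simp add: lub_in_def)

lemma lubI: "(\<And>n. f n \<le> s) \<Longrightarrow> (\<And>y. (\<And>n. f n \<le> y) \<Longrightarrow> s \<le> y) \<Longrightarrow> lub f s"
  by (simp add: lub_in_def)

lemma lub_unique: "lub f s \<Longrightarrow> lub f s' \<Longrightarrow> s = s'"
  by (meson antisym lub_least lub_upper)

lemma lub_add:
  "incseq f \<Longrightarrow> incseq g \<Longrightarrow> lub f x \<Longrightarrow> lub g y \<Longrightarrow> lub (\<lambda>n. f n + g n) (x + y)"
  using cu by (simp add: cu_semigroup_def incseq_in_UNIV)

lemma wb_lubD: "x \<lless> y \<Longrightarrow> incseq f \<Longrightarrow> lub f s \<Longrightarrow> y \<le> s \<Longrightarrow> \<exists>m. x \<le> f m"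
  by (auto simp: wb_eq wb_in_def incseq_in_UNIV)

lemma wb_mono: "x \<lless> y \<Longrightarrow> x' \<le> x \<Longrightarrow> y \<le> y' \<Longrightarrow> x' \<lless> y'"
  unfolding wb_eq wb_in_def by (meson order.trans)

lemma le_wb_trans: "x' \<le> x \<Longrightarrow> x \<lless> y \<Longrightarrow> x' \<lless> y"
  and wb_le_trans: "x \<lless> y \<Longrightarrow> y \<le> y' \<Longrightarrow> x \<lless> y'"
  by (auto intro: wb_mono)

lemma wb_le: "x \<lless> y \<Longrightarrow> x \<le> y"
  using wb_lubD[of x y "\<lambda>_. y" y] by (auto intro: lubI)

lemma wb_trans: "x \<lless> y \<Longrightarrow> y \<lless> z \<Longrightarrow> x \<lless> z"
  by (blast intro: wb_le wb_le_trans)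

lemma wb_add: "x' \<lless> x \<Longrightarrow> y' \<lless> y \<Longrightarrow> x' + y' \<lless> x + y"
  using cu by (simp add: cu_semigroup_def wb_eq)

lemma zero_wb [simp]: "0 \<lless> x"
  by (auto simp: wb_eq wb_in_def)

lemma wb_approx: obtains f where "incseq f" "lub f x" "\<And>n. f n \<lless> f (Suc n)" "\<And>n. f n \<lless> x"
proof -
  have "\<exists>f. (\<forall>n. f n \<lless> f (Suc n)) \<and> lub f x"
    using cu by (simp add: cu_semigroup_def wb_eq)
  then obtain f where f: "\<forall>n. f n \<lless> f (Suc n)" "lub f x"
    by blast
  then have "incseq f"
    by (simp add: incseq_Suc_iff wb_le)
  moreover have "f n \<lless> x" for n
    using f lub_upper wb_le_trans by blast
  ultimately show ?thesis
    using f that by blast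
qed

lemma wb_interpolate: assumes "x \<lless> z" obtains y where "x \<lless> y" "y \<lless> z"
proof -
  obtain f where f: "incseq f" "lub f z" "\<And>n. f n \<lless> f (Suc n)" "\<And>n. f n \<lless> z"
    using wb_approx[of z] by blast
  obtain m where "x \<le> f m"
    using wb_lubD[OF assms f(1,2)] by auto
  then show ?thesis
    using f(3,4) le_wb_trans that by blast
qed

lemma wb_directed: assumes "x \<lless> z" "y \<lless> z" obtains w where "x \<lless> w" "y \<lless> w" "w \<lless> z"
proof -
  obtain f where f: "incseq f" "lub f z" "\<And>n. f n \<lless> f (Suc n)" "\<And>n. f n \<lless> z"
    using wb_approx[of z] by blast
  obtain m k where "x \<le> f m" "y \<le> f k"
    using wb_lubD[OF assms(1) f(1,2)] wb_lubD[OF assms(2) f(1,2)] by auto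
  then have "x \<le> f (max m k)" "y \<le> f (max m k)"
    using f(1) by (meson incseqD max.cobounded1 max.cobounded2 order.trans)+
  then show ?thesis
    using f(3,4) le_wb_trans that by blast
qed

lemma le_by_wb: assumes "\<And>x'. x' \<lless> x \<Longrightarrow> x' \<le> y" shows "x \<le> y"
  by (rule wb_approx[of x]) (blast intro: assms lub_least)

text \<open>By O4 the sums of approximating sequences of \<open>x\<close> and \<open>y\<close> have
  supremum \<open>x + y\<close>, so one of these sums dominates an interpolant.\<close>

lemma wb_add_split:
  assumes "z \<lless> x + y" obtains x' y' where "x' \<lless> x" "y' \<lless> y" "z \<lless> x' + y'"
proof -
  obtain z' where z': "z \<lless> z'" "z' \<lless> x + y"
    using assms wb_interpolate by blast
  obtain f where f: "incseq f" "lub f x" "\<And>n. f n \<lless> f (Suc n)" "\<And>n. f n \<lless> x"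
    using wb_approx[of x] by blast
  obtain g where g: "incseq g" "lub g y" "\<And>n. g n \<lless> g (Suc n)" "\<And>n. g n \<lless> y"
    using wb_approx[of y] by blast
  have "incseq (\<lambda>n. f n + g n)"
    using f(1) g(1) by (simp add: incseq_def add_mono)
  then obtain m where "z' \<le> f m + g m"
    using wb_lubD[OF z'(2) _ lub_add[OF f(1) g(1) f(2) g(2)]] by blast
  then show ?thesis
    using that f(4) g(4) z'(1) wb_le_trans by blast
qed

lemma nmul_le_nmul: "m \<le> n \<Longrightarrow> nmul m x \<le> nmul n (x::'a)"
  by (metis le_add_right le_add_diff_inverse nmul_add)

lemma incseq_nmul: "incseq (\<lambda>n. nmul n (x::'a))"
  by (simp add: incseq_def nmul_le_nmul)

lemma wb_nmul_split: assumes "z \<lless> nmul n x" obtains x' where "x' \<lless> x" "z \<lless> nmul n x'"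
proof -
  have "\<exists>x'. x' \<lless> x \<and> z \<lless> nmul n x'"
    using assms
  proof (induction n arbitrary: z)
    case 0
    then show ?case by (intro exI[of _ 0]) simp
  next
    case (Suc n)
    then obtain a b where ab: "a \<lless> x" "b \<lless> nmul n x" "z \<lless> a + b"
      by (metis nmul.simps(2) wb_add_split)
    then obtain c where c: "c \<lless> x" "b \<lless> nmul n c"
      using Suc.IH by blast
    obtain d where d: "a \<lless> d" "c \<lless> d" "d \<lless> x"
      using ab(1) c(1) wb_directed by blast
    have "a + b \<le> d + nmul n d"
      using d c(2) by (meson add_mono nmul_mono order.trans wb_le)
    then show ?case
      using d(3) ab(3) wb_le_trans by auto
  qed
  then show ?thesis using that by blast
qed

section \<open>Infinite multiples and the ideals they generate\<close>

lemma lub_infty: "lub (\<lambda>n. nmul n x) (infty x)"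
proof -
  obtain s where s: "lub (\<lambda>n. nmul n x) s"
    using lub_ex incseq_nmul by blast
  then have "infty x = s"
    unfolding infty_eq infty_in_def by (rule the_equality) (rule lub_unique[OF _ s])
  then show ?thesis
    using s by simp
qed

lemma nmul_le_infty: "nmul n x \<le> infty x"
  by (rule lub_upper[OF lub_infty])

lemma le_infty: "x \<le> infty x"
  using nmul_le_infty[of "Suc 0" x] by simp

lemma infty_add_self: "infty x + infty x = infty x"
proof (rule lub_unique)
  show "lub (\<lambda>n. nmul n x + nmul n x) (infty x + infty x)"
    by (intro lub_add incseq_nmul lub_infty)
  show "lub (\<lambda>n. nmul n x + nmul n x) (infty x)"
  proof (rule lubI)
    show "nmul n x + nmul n x \<le> infty x" for n
      using nmul_le_infty[of "n + n" x] by (simp add: nmul_add)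
    show "infty x \<le> y" if "\<And>n. nmul n x + nmul n x \<le> y" for y
      using that by (intro lub_least[OF lub_infty]) (meson le_add_right order.trans)
  qed
qed

lemma add_le_infty: "x \<le> infty z \<Longrightarrow> y \<le> infty z \<Longrightarrow> x + y \<le> infty z"
  by (metis add_mono infty_add_self)

lemma nmul_le_inftyI: "x \<le> infty z \<Longrightarrow> nmul n x \<le> infty z"
  by (induction n) (auto intro: add_le_infty)

lemma infty_le_infty: "x \<le> infty y \<Longrightarrow> infty x \<le> infty y"
  by (auto intro: lub_least[OF lub_infty] nmul_le_inftyI)

lemma infty_mono: "x \<le> y \<Longrightarrow> infty x \<le> infty y"
  using infty_le_infty le_infty order.trans by blast

lemma le_infty_trans: "x \<le> infty y \<Longrightarrow> y \<le> infty z \<Longrightarrow> x \<le> infty z"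
  using infty_le_infty order.trans by blast

lemma wb_infty_nmulE: assumes "z \<lless> infty x" obtains n x' where "x' \<lless> x" "z \<lless> nmul n x'"
proof -
  obtain z' where z': "z \<lless> z'" "z' \<lless> infty x"
    using assms wb_interpolate by blast
  obtain n where "z' \<le> nmul n x"
    using wb_lubD[OF z'(2) incseq_nmul lub_infty] by auto
  then show ?thesis
    using z'(1) that wb_nmul_split wb_le_trans by metis
qed

lemma wb_infty_nmul: assumes "z \<lless> infty x" obtains n where "z \<le> nmul n x"
  using wb_lubD[OF assms incseq_nmul lub_infty] that by auto

lemma wb_inftyE: assumes "z \<lless> infty x" obtains x' where "x' \<lless> x" "z \<lless> infty x'"
proof -
  obtain n x' where "x' \<lless> x" "z \<lless> nmul n x'"
    using assms by (rule wb_infty_nmulE)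
  then show ?thesis
    using that nmul_le_infty wb_le_trans by blast
qed

section \<open>Closure properties of strongly soft elements\<close>

definition soft :: "'a \<Rightarrow> bool" where
  "soft x \<longleftrightarrow> strongly_soft_in UNIV x"

lemma softD: assumes "soft x" "x' \<lless> x" obtains t where "x' + t \<lless> x" "x' \<lless> infty t"
  using assms unfolding soft_def strongly_soft_in_def wb_eq infty_eq by blast

text \<open>Interpolation turns both inequalities into way-below relations, so \<open>\<le>\<close>
  suffices.\<close>

lemma softI:
  assumes "\<And>x'. x' \<lless> x \<Longrightarrow> \<exists>t. x' + t \<le> x \<and> x' \<le> infty t"
  shows "soft x"
  unfolding soft_def strongly_soft_in_def wb_eq[symmetric] infty_eq[symmetric]
proof (intro conjI ballI impI)
  fix x' assume "x' \<lless> x"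
  then obtain x'' where x'': "x' \<lless> x''" "x'' \<lless> x"
    using wb_interpolate by blast
  then obtain t where t: "x'' + t \<le> x" "x'' \<le> infty t"
    using assms by blast
  then obtain t' where t': "t' \<lless> t" "x' \<lless> infty t'"
    using wb_inftyE wb_le_trans x''(1) by metis
  then have "x' + t' \<lless> x"
    using wb_add[OF x''(1) t'(1)] t(1) wb_le_trans by blast
  then show "\<exists>t\<in>UNIV. x' + t \<lless> x \<and> x' \<lless> infty t"
    using t' by blast
qed simp

lemma soft_zero: "soft 0"
  by (rule softI) (auto dest!: wb_le intro!: exI[of _ 0] intro: order.trans le_infty)

lemma soft_lub: assumes "incseq f" "lub f s" "\<And>n. soft (f n)" shows "soft s"
proof (rule softI)
  fix x' assume "x' \<lless> s"
  then obtain x'' where x'': "x' \<lless> x''" "x'' \<lless> s"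
    using wb_interpolate by blast
  then obtain m where "x'' \<le> f m"
    using wb_lubD assms by blast
  then obtain t where "x' + t \<lless> f m" "x' \<lless> infty t"
    using softD assms(3) x''(1) wb_le_trans by metis
  then show "\<exists>t. x' + t \<le> s \<and> x' \<le> infty t"
    using assms(2) lub_upper order.trans wb_le by blast
qed

text \<open>A part \<open>w\<close> of \<open>v\<close> that dominates \<open>x'\<close> is absorbed
  into \<open>v''\<close>; the \<open>t\<close> that softness provides for \<open>v''\<close> then
  dominates all of \<open>z\<close>.\<close>

lemma soft_add_dominated: assumes "soft v" "x \<le> infty v" shows "soft (x + v)"
proof (rule softI)
  fix z assume "z \<lless> x + v"
  then obtain x' v' where xv: "x' \<lless> x" "v' \<lless> v" "z \<lless> x' + v'"
    by (rule wb_add_split)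
  obtain w where w: "w \<lless> v" "x' \<lless> infty w"
    using wb_inftyE[OF wb_le_trans[OF xv(1) assms(2)]] by blast
  obtain v'' where v'': "v' \<lless> v''" "w \<lless> v''" "v'' \<lless> v"
    using xv(2) w(1) wb_directed by blast
  obtain t where t: "v'' + t \<lless> v" "v'' \<lless> infty t"
    using softD assms(1) v''(3) by blast
  have "z + t \<le> x' + (v'' + t)"
    using xv(3) v''(1) by (metis (no_types, opaque_lifting) add.assoc add_mono order.refl order.trans wb_le)
  also have "\<dots> \<le> x + v"
    using xv(1) t(1) by (simp add: add_mono wb_le)
  finally have "z + t \<le> x + v" .
  moreover have "x' \<le> infty t" "v' \<le> infty t"
    using w(2) v'' t(2) by (meson infty_le_infty order.trans wb_le)+
  then have "z \<le> infty t"
    using xv(3) by (meson add_le_infty order.trans wb_le)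
  ultimately show "\<exists>t. z + t \<le> x + v \<and> z \<le> infty t"
    by blast
qed

lemma soft_add: assumes "soft v" "soft x" shows "soft (x + v)"
proof (rule softI)
  fix z assume "z \<lless> x + v"
  then obtain x' v' where xv: "x' \<lless> x" "v' \<lless> v" "z \<lless> x' + v'"
    by (rule wb_add_split)
  obtain s where s: "x' + s \<lless> x" "x' \<lless> infty s"
    using softD assms(2) xv(1) by blast
  obtain t where t: "v' + t \<lless> v" "v' \<lless> infty t"
    using softD assms(1) xv(2) by blast
  have "z + (s + t) \<le> (x' + v') + (s + t)"
    using xv(3) by (simp add: add_right_mono wb_le)
  also have "\<dots> = (x' + s) + (v' + t)"
    by (simp add: ac_simps)
  also have "\<dots> \<le> x + v"
    using s(1) t(1) by (simp add: add_mono wb_le)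
  finally have "z + (s + t) \<le> x + v" .
  moreover have "x' \<le> infty (s + t)" "v' \<le> infty (s + t)"
    using s(2) t(2) by (meson infty_mono le_add_left le_add_right order.trans wb_le)+
  then have "z \<le> infty (s + t)"
    using xv(3) by (meson add_le_infty order.trans wb_le)
  ultimately show "\<exists>t. z + t \<le> x + v \<and> z \<le> infty t"
    by blast
qed

lemma soft_nmul: "soft v \<Longrightarrow> soft (nmul n v)"
  by (induction n) (simp_all add: soft_zero soft_add)

text \<open>Soft elements are closed under suprema of increasing sequences. This lets continuity of
  functionals pass between \<open>S\<close> and its soft part.\<close>

lemma lub_soft_part:
  assumes "incseq_in (soft_part UNIV) f"
  shows "lub_in (soft_part UNIV) f s \<longleftrightarrow> lub f s"
proof -
  have f: "incseq f" "\<And>n. soft (f n)"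
    using assms by (auto simp: incseq_in_def soft_part_def soft_def incseq_Suc_iff)
  obtain r where r: "lub f r"
    using f(1) lub_ex by blast
  then have rs: "r \<in> soft_part UNIV"
    using soft_lub f by (auto simp: soft_part_def soft_def)
  show ?thesis
  proof
    assume s: "lub_in (soft_part UNIV) f s"
    have "s = r"
      using s r rs by (metis UNIV_I antisym lub_in_def)
    then show "lub f s" using r by simp
  next
    assume "lub f s"
    then have "s = r" using r lub_unique by blast
    then show "lub_in (soft_part UNIV) f s"
      using r rs by (simp add: lub_in_def)
  qed
qed

end

section \<open>Soft replicas\<close>

locale cu_div = cu_sgrp wb infty
  for wb :: "'a::ordered_comm_monoid_add \<Rightarrow> 'a \<Rightarrow> bool" (infix "\<lless>" 50) and infty +
  assumes div: "two_omega_divisible (UNIV :: 'a set)"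
    and O5: "O5 (UNIV :: 'a set)" and O6: "O6 (UNIV :: 'a set)" and O7: "O7 (UNIV :: 'a set)"
begin

section \<open>Division and soft elements generating a given ideal\<close>

lemma O5E:
  assumes "x + y \<le> z" "x' \<lless> x" "y' \<lless> y"
  obtains c where "y' \<lless> c" "x' + c \<le> z" "z \<le> x + c"
  using assms O5 unfolding O5_def wb_eq by blast

lemma O6E:
  assumes "x' \<lless> x" "x \<le> y + z"
  obtains v w where "v \<le> x" "v \<le> y" "w \<le> x" "w \<le> z" "x' \<le> v + w"
  using assms O6 unfolding O6_def wb_eq by blast

lemma O7E:
  assumes "x' \<lless> x" "x \<le> w" "y' \<lless> y" "y \<le> w"
  obtains z where "x' \<lless> z" "y' \<lless> z" "z \<le> w" "z \<le> x + y"
  using assms O7 unfolding O7_def wb_eq by blast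

lemma halveE:
  assumes "x' \<lless> x" obtains y where "y + y \<le> x" "x' \<le> infty y"
  using assms div unfolding two_omega_divisible_def wb_eq infty_eq by blast

lemma halve_wbE:
  assumes "q \<lless> infty x" obtains y where "y + y \<le> x" "q \<lless> infty y"
proof -
  obtain x' where x': "x' \<lless> x" "q \<lless> infty x'"
    using assms by (rule wb_inftyE)
  obtain y where y: "y + y \<le> x" "x' \<le> infty y"
    using x'(1) by (rule halveE)
  show ?thesis
    using that[OF y(1)] wb_le_trans[OF x'(2) infty_le_infty[OF y(2)]] .
qed

lemma divide_pow2: "q \<lless> infty x \<Longrightarrow> \<exists>y. nmul (2 ^ k) y \<le> x \<and> q \<lless> infty y"
proof (induction k arbitrary: x)
  case 0
  then show ?case by (intro exI[of _ x]) simp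
next
  case (Suc k)
  obtain z where z: "z + z \<le> x" "q \<lless> infty z"
    using Suc.prems by (rule halve_wbE)
  then obtain y where y: "nmul (2 ^ k) y \<le> z" "q \<lless> infty y"
    using Suc.IH by blast
  have "nmul (2 ^ Suc k) y \<le> z + z"
    using y(1) by (simp add: mult_2 nmul_add add_mono)
  then show ?case
    using z y order.trans by blast
qed

lemma divide_wbE:
  assumes "q \<lless> infty x" obtains y where "nmul n y \<le> x" "q \<lless> infty y"
proof -
  obtain y where y: "nmul (2 ^ n) y \<le> x" "q \<lless> infty y"
    using divide_pow2[OF assms] by blast
  have "nmul n y \<le> nmul (2 ^ n) y"
    by (simp add: nmul_le_nmul less_imp_le)
  then show ?thesis
    using that y order.trans by blast
qed

text \<open>A later summand \<open>u m\<close> is the witness of softness: it can be added to the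
  partial sum dominating \<open>z\<close> without leaving \<open>w\<close>.\<close>

lemma soft_series:
  assumes w: "lub (\<lambda>n. \<Sum>k<n. u k) w"
    and dom: "\<And>z n. z \<lless> w \<Longrightarrow> \<exists>m\<ge>n. z \<le> infty (u m)"
  shows "soft w"
proof (rule softI)
  have inc: "incseq (\<lambda>n. \<Sum>k<n. u k)"
    by (simp add: incseq_Suc_iff le_add_right)
  fix z assume z: "z \<lless> w"
  obtain n where n: "z \<le> (\<Sum>k<n. u k)"
    using wb_lubD[OF z inc w] by auto
  obtain m where m: "m \<ge> n" "z \<le> infty (u m)"
    using dom[OF z] by blast
  have "z \<le> (\<Sum>k<m. u k)"
    using n incseqD[OF inc m(1)] by (rule order.trans)
  then have "z + u m \<le> (\<Sum>k<Suc m. u k)"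
    by (simp add: add_right_mono)
  also have "\<dots> \<le> w"
    using w by (rule lub_upper)
  finally show "\<exists>t. z + t \<le> w \<and> z \<le> infty t"
    using m(2) by blast
qed

text \<open>The room left below \<open>x\<close> is halved again and again: one half receives the
  next piece, the other stays free. Each piece lies in the ideal of the next one, so every later
  piece can witness softness of the sum.\<close>

lemma soft_below:
  assumes "q \<lless> infty x" obtains w where "soft w" "w \<le> x" "q \<lless> infty w"
proof -
  define R where "R = (\<lambda>(a, b) (a', b'). b' + b' \<le> b \<and> a \<lless> infty a' \<and> a' \<lless> (b'::'a))"
  have "\<exists>f. \<forall>n. (fst (f n) \<lless> infty (snd (f n)) \<and> (n = 0 \<longrightarrow> f n = (q, x))) \<and> R (f n) (f (Suc n))"
  proof (rule dependent_nat_choice)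
    show "\<exists>p. fst p \<lless> infty (snd p) \<and> ((0::nat) = 0 \<longrightarrow> p = (q, x))"
      using assms by auto
  next
    fix p :: "'a \<times> 'a" and n :: nat
    assume "fst p \<lless> infty (snd p) \<and> (n = 0 \<longrightarrow> p = (q, x))"
    then have "fst p \<lless> infty (snd p)" by simp
    then obtain y where y: "y + y \<le> snd p" "fst p \<lless> infty y"
      by (rule halve_wbE)
    obtain y' where y': "y' \<lless> y" "fst p \<lless> infty y'"
      using y(2) by (rule wb_inftyE)
    have "y' \<lless> infty y"
      using y'(1) le_infty by (rule wb_le_trans)
    then show "\<exists>p'. (fst p' \<lless> infty (snd p') \<and> (Suc n = 0 \<longrightarrow> p' = (q, x))) \<and> R p p'"
      using y y' by (intro exI[of _ "(y', y)"]) (auto simp: R_def split: prod.splits)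
  qed
  then obtain f where f: "f 0 = (q, x)" "\<And>n. R (f n) (f (Suc n))"
    by blast
  define a b where "a = (\<lambda>n. fst (f n))" and "b = (\<lambda>n. snd (f n))"
  have ab0: "a 0 = q" "b 0 = x"
    using f(1) by (simp_all add: a_def b_def)
  have ab: "b (Suc n) + b (Suc n) \<le> b n" "a n \<lless> infty (a (Suc n))" "a (Suc n) \<lless> b (Suc n)" for n
    using f(2)[of n] by (auto simp: R_def a_def b_def split: prod.splits)
  have mono: "a m \<le> infty (a n)" if "m \<le> n" for m n
    using that
  proof (induction rule: dec_induct)
    case base
    show ?case by (rule le_infty)
  next
    case (step n)
    then show ?case using ab(2) le_infty_trans wb_le by blast
  qed
  \<comment> \<open>The sum starts at \<open>a 1\<close>: the element \<open>a 0 = q\<close> need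
    not fit below \<open>x\<close> and only fixes the ideal to be reached.\<close>
  let ?W = "\<lambda>n. \<Sum>k<n. a (Suc k)"
  have room: "?W n + b n \<le> x" for n
  proof (induction n)
    case 0
    then show ?case by (simp add: ab0)
  next
    case (Suc n)
    have "a (Suc n) + b (Suc n) \<le> b n"
      using ab(1,3) by (meson add_right_mono order.trans wb_le)
    then show ?case
      using Suc by (simp add: add.assoc) (meson add_left_mono order.trans)
  qed
  have inc: "incseq ?W"
    by (simp add: incseq_Suc_iff le_add_right)
  then obtain w where w: "lub ?W w"
    using lub_ex by blast
  have "soft w"
  proof (rule soft_series[OF w])
    fix z n assume z: "z \<lless> w"
    obtain m where m: "z \<le> ?W m"
      using wb_lubD[OF z inc w] by auto
    have "?W m \<le> infty (a (Suc l))" if "m \<le> l" for l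
      using that by (induction m) (auto intro!: add_le_infty mono)
    then have "?W m \<le> infty (a (Suc (max m n)))"
      by simp
    then show "\<exists>l\<ge>n. z \<le> infty (a (Suc l))"
      using m order.trans by (intro exI[of _ "max m n"]) auto
  qed
  moreover have "w \<le> x"
    using w room by (rule_tac lub_least) (auto intro: order.trans[OF le_add_right])
  moreover have "a (Suc 0) \<le> w"
    using lub_upper[OF w, of "Suc 0"] by simp
  then have "q \<lless> infty w"
    using ab(2)[of 0] ab0 infty_mono wb_le_trans by metis
  ultimately show ?thesis
    using that by blast
qed

text \<open>In O5 the same \<open>y'\<close> serves as first summand and as lower bound of the complement \<open>d\<close>;
  hence splitting off \<open>y''\<close> does not change the ideal generated by \<open>c\<close>.\<close>

lemma complementE:
  assumes "y + y \<le> c" "y'' \<lless> y'" "y' \<lless> y"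
  obtains d where "y'' + d \<le> c" "c \<le> y' + d" "y' \<lless> d" "c \<le> infty d"
proof -
  have "y' + y \<le> c"
    using assms(1,3) add_right_mono order.trans wb_le by blast
  then obtain d where d: "y' \<lless> d" "y'' + d \<le> c" "c \<le> y' + d"
    using O5E assms(2,3) by blast
  have "c \<le> infty d"
    using d(1,3) add_le_infty le_infty order.trans wb_le by meson
  then show ?thesis
    using that d by blast
qed

lemma lub_nmul: "incseq f \<Longrightarrow> lub f x \<Longrightarrow> lub (\<lambda>k. nmul n (f k)) (nmul n x)"
proof (induction n)
  case 0
  then show ?case by (auto intro: lubI)
next
  case (Suc n)
  have "incseq (\<lambda>k. nmul n (f k))"
    using Suc.prems(1) by (simp add: incseq_def nmul_mono)
  then show ?case
    using Suc by (simp add: lub_add)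
qed

text \<open>Removing a piece by \<open>complementE\<close> leaves a complement that still generates
  \<open>x\<close>, so the removal can be repeated with pieces dominating ever larger approximants
  of \<open>x\<close>. Each piece is cut into \<open>n\<close> parts and only one part is
  summed.\<close>

lemma soft_fraction:
  assumes "n > 0" obtains w where "soft w" "nmul n w \<le> x" "x \<le> infty w"
proof -
  obtain e where e: "incseq e" "lub e x" "\<And>k. e k \<lless> e (Suc k)" "\<And>k. e k \<lless> x"
    using wb_approx[of x] by blast
  define R where "R = (\<lambda>k (a::'a, c) (u, d). nmul n u + d \<le> c \<and> e k \<le> infty u)"
  have "\<exists>f. \<forall>k. (x \<le> infty (snd (f k)) \<and> (k = 0 \<longrightarrow> f k = (0, x))) \<and> R k (f k) (f (Suc k))"
  proof (rule dependent_nat_choice)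
    show "\<exists>p. x \<le> infty (snd p) \<and> ((0::nat) = 0 \<longrightarrow> p = (0, x))"
      by (auto intro: le_infty)
  next
    fix p :: "'a \<times> 'a" and k :: nat
    assume "x \<le> infty (snd p) \<and> (k = 0 \<longrightarrow> p = (0, x))"
    then have xc: "x \<le> infty (snd p)" by simp
    have "e k \<lless> infty (snd p)"
      using e(4) xc by (rule wb_le_trans)
    then obtain y where y: "y + y \<le> snd p" "e k \<lless> infty y"
      by (rule halve_wbE)
    obtain y'' where y'': "y'' \<lless> y" "e k \<lless> infty y''"
      using y(2) by (rule wb_inftyE)
    obtain y' where y': "y'' \<lless> y'" "y' \<lless> y"
      using y''(1) by (rule wb_interpolate)
    obtain d where d: "y'' + d \<le> snd p" "snd p \<le> infty d"
      using complementE[OF y(1) y'] by blast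
    obtain u where u: "nmul n u \<le> y''" "e k \<lless> infty u"
      using y''(2) by (rule divide_wbE)
    have "nmul n u + d \<le> snd p"
      using u(1) d(1) add_right_mono order.trans by blast
    moreover have "x \<le> infty d"
      using xc d(2) by (rule le_infty_trans)
    ultimately show "\<exists>p'. (x \<le> infty (snd p') \<and> (Suc k = 0 \<longrightarrow> p' = (0, x))) \<and> R k p p'"
      using u(2) by (intro exI[of _ "(u, d)"]) (auto simp: R_def wb_le split: prod.splits)
  qed
  then obtain f where f: "f 0 = (0, x)" "\<And>k. R k (f k) (f (Suc k))"
    by blast
  define u c where "u = (\<lambda>k. fst (f (Suc k)))" and "c = (\<lambda>k. snd (f k))"
  have uc: "c 0 = x" "nmul n (u k) + c (Suc k) \<le> c k" "e k \<le> infty (u k)" for k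
    using f(1) f(2)[of k] by (auto simp: R_def u_def c_def split: prod.splits)
  let ?W = "\<lambda>n. \<Sum>k<n. u k"
  have room: "nmul n (?W k) + c k \<le> x" for k
  proof (induction k)
    case 0
    have "nmul n (0::'a) = 0"
      by (induction n) simp_all
    then show ?case by (simp add: uc)
  next
    case (Suc k)
    have "nmul n (?W (Suc k)) + c (Suc k) = nmul n (?W k) + (nmul n (u k) + c (Suc k))"
      by (simp add: nmul_add_distrib add.assoc)
    also have "\<dots> \<le> nmul n (?W k) + c k"
      using uc(2) by (rule add_left_mono)
    finally show ?case
      using Suc by (rule order.trans)
  qed
  have inc: "incseq ?W"
    by (simp add: incseq_Suc_iff le_add_right)
  then obtain w where w: "lub ?W w"
    using lub_ex by blast
  have nw: "nmul n w \<le> x"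
    using lub_nmul[OF inc w] room
    by (rule_tac lub_least) (auto intro: order.trans[OF le_add_right])
  have wx: "w \<le> x"
    using nw nmul_le_nmul[of 1 n w] assms by (auto intro: order.trans)
  have uw: "u k \<le> w" for k
    using lub_upper[OF w, of "Suc k"] le_add_left[of "u k" "?W k"] by (auto intro: order.trans)
  have "soft w"
  proof (rule soft_series[OF w])
    fix z m assume z: "z \<lless> w"
    obtain l where "z \<le> e l"
      using wb_lubD[OF z e(1,2) wx] by blast
    then have "z \<le> e (max l m)"
      using incseqD[OF e(1), of l "max l m"] by (auto intro: order.trans)
    then have "z \<le> infty (u (max l m))"
      using uc(3) order.trans by blast
    then show "\<exists>l\<ge>m. z \<le> infty (u l)"
      by (intro exI[of _ "max l m"]) simp
  qed
  moreover have "x \<le> infty w"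
    using e(2) by (rule lub_least) (meson uc(3) uw infty_mono order.trans)
  ultimately show ?thesis
    using that nw by blast
qed

section \<open>Construction of soft replicas\<close>

definition has_room :: "'a \<Rightarrow> 'a \<Rightarrow> bool" where
  "has_room x d \<longleftrightarrow> d \<lless> x \<and> (\<exists>t. d + t \<le> x \<and> x \<le> infty t)"

text \<open>The inductive step in building a replica. Part of the room left by \<open>d\<close> pays
  for the increment \<open>s\<close>, which makes the limit soft; another part stays free for the
  next step. \<open>v\<close> is the error made at \<open>e0\<close>.\<close>

lemma has_room_step:
  assumes d: "d2 \<lless> d" "has_room x d" and e0: "e0 \<lless> x"
  obtains z' z s v where "z' \<lless> z" "has_room x z" "d2 + s \<le> z'" "d2 \<le> infty s"
    "e0 \<le> z' + v" "v \<le> z'" "nmul n v \<le> x"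
proof -
  obtain t where t: "d \<lless> x" "d + t \<le> x" "x \<le> infty t"
    using d(2) by (auto simp: has_room_def)
  \<comment> \<open>Two copies of \<open>u\<close> must fit into \<open>t\<close> even for
    \<open>n = 0\<close>; \<open>n\<close> copies bound the error.\<close>
  obtain u where u: "nmul (Suc (Suc n)) u \<le> t" "t \<le> infty u"
    using soft_fraction[of "Suc (Suc n)" t] by blast
  have xu: "x \<le> infty u"
    using t(3) u(2) by (rule le_infty_trans)
  have tx: "t \<le> x"
    using le_add_left t(2) by (rule order.trans)
  have uu: "u + u \<le> t"
    using u(1) by (metis add.right_neutral add_left_mono nmul.simps(2) order.trans zero_least)
  have nu: "nmul n u \<le> x"
    using nmul_le_nmul[of n "Suc (Suc n)" u] u(1) tx by (meson le_SucI order.refl order.trans)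
  obtain e1 where e1: "e0 \<lless> e1" "e1 \<lless> x"
    using e0 by (rule wb_interpolate)
  obtain e2 where e2: "e1 \<lless> e2" "e2 \<lless> x"
    using e1(2) by (rule wb_interpolate)
  obtain b where b: "d \<lless> b" "e2 \<lless> b" "b \<lless> x"
    using t(1) e2(2) by (rule wb_directed)
  \<comment> \<open>The piece \<open>u\<close> is used in shrinking versions: \<open>ud\<close> is
    removed from \<open>x\<close>, \<open>uc\<close> is kept free, \<open>ub\<close> bounds the
    ideal of \<open>z\<close>, and \<open>ua\<close> is the increment.\<close>
  obtain ua where ua: "ua \<lless> u" "b \<lless> infty ua"
    using wb_inftyE[OF wb_le_trans[OF b(3) xu]] by blast
  obtain ub where ub: "ua \<lless> ub" "ub \<lless> u"
    using ua(1) by (rule wb_interpolate)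
  obtain uc where uc: "ub \<lless> uc" "uc \<lless> u"
    using ub(2) by (rule wb_interpolate)
  obtain ud where ud: "uc \<lless> ud" "ud \<lless> u"
    using uc(2) by (rule wb_interpolate)
  obtain d1 where d1: "d2 \<lless> d1" "d1 \<lless> d"
    using d(1) by (rule wb_interpolate)
  \<comment> \<open>O5 is applied with \<open>d + u\<close> as second summand, so that the
    complement \<open>g\<close> of \<open>ud\<close> contains the old stage together with another
    copy of the piece.\<close>
  have "ud + (d + u) = d + (ud + u)"
    by (simp add: ac_simps)
  also have "\<dots> \<le> d + t"
    using ud(2) uu by (meson add_left_mono add_right_mono order.trans wb_le)
  also have "\<dots> \<le> x"
    by (rule t(2))
  finally obtain g where g: "d1 + ud \<lless> g" "uc + g \<le> x" "x \<le> ud + g"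
    using O5E[OF _ ud(1) wb_add[OF d1(2) ud(2)]] by blast
  \<comment> \<open>O6 splits the approximant; its part below \<open>ud\<close> is the error
    \<open>v\<close>, which is small because \<open>ud \<le> u\<close>.\<close>
  have "e2 \<le> ud + g"
    using order.trans[OF wb_le[OF e2(2)] g(3)] .
  then obtain v w where vw: "v \<le> e2" "v \<le> ud" "w \<le> e2" "w \<le> g" "e1 \<le> v + w"
    using O6E[OF e2(1)] by blast
  obtain v1 w1 where vw1: "v1 \<lless> v" "w1 \<lless> w" "e0 \<lless> v1 + w1"
    using wb_le_trans[OF e1(1) vw(5)] by (rule wb_add_split)
  \<comment> \<open>The error is below \<open>g\<close> too, so O7 joins it with \<open>w1\<close>
    inside \<open>g\<close>; this finally gives \<open>v1 \<le> z'\<close>.\<close>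
  have "v \<le> g"
    using order.trans[OF vw(2) order.trans[OF le_add_left wb_le[OF g(1)]]] .
  then obtain p where p: "v1 \<lless> p" "w1 \<lless> p" "p \<le> g" "p \<le> v + w"
    using O7E[OF vw1(1) _ vw1(2) vw(4)] by blast
  obtain p1 where p1: "v1 \<lless> p1" "w1 \<lless> p1" "p1 \<lless> p"
    using p(1,2) by (rule wb_directed)
  have "ub \<le> ud"
    using uc(1) ud(1) wb_trans wb_le by blast
  then have "d1 + ub \<le> g"
    using order.trans[OF add_left_mono wb_le[OF g(1)]] by blast
  \<comment> \<open>The second use of O7 brings in the old stage and the increment; the bound
    \<open>p + (d1 + ub)\<close> confines \<open>z\<close> to the ideal of
    \<open>ub\<close>.\<close>
  then obtain z where z: "p1 \<lless> z" "d2 + ua \<lless> z" "z \<le> g" "z \<le> p + (d1 + ub)"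
    using O7E[OF p1(3) p(3) wb_add[OF d1(1) ub(1)]] by blast
  have bub: "b \<le> infty ub"
    using order.trans[OF wb_le[OF ua(2)] infty_mono[OF wb_le[OF ub(1)]]] .
  have "v \<le> infty ub" "w \<le> infty ub" "d1 \<le> infty ub"
    using bub vw(1,3) b(1,2) d1(2) by (meson order.trans wb_le)+
  then have zub: "z \<le> infty ub"
    using z(4) p(4) by (meson add_le_infty le_infty order.trans)
  obtain z' where z': "p1 \<lless> z'" "d2 + ua \<lless> z'" "z' \<lless> z"
    using z(1,2) by (rule wb_directed)
  obtain z'' where z'': "z' \<lless> z''" "z'' \<lless> z"
    using z'(3) by (rule wb_interpolate)
  \<comment> \<open>The free piece \<open>uc\<close> need not be full in \<open>x\<close>. O5
    replaces it by \<open>c\<close> above \<open>ub\<close>; as \<open>z\<close> lies in the ideal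
    of \<open>c\<close>, the inequality \<open>x \<le> z + c\<close> makes \<open>c\<close>
    full.\<close>
  have "z + uc \<le> x"
    using z(3) g(2) by (metis add.commute add_left_mono order.trans)
  then obtain c where c: "ub \<lless> c" "z'' + c \<le> x" "x \<le> z + c"
    using O5E[OF _ z''(2) uc(1)] by blast
  have "z \<le> infty c"
    using order.trans[OF zub infty_mono[OF wb_le[OF c(1)]]] .
  then have "x \<le> infty c"
    using c(3) by (meson add_le_infty le_infty order.trans)
  moreover have "z'' \<lless> x"
    using z''(2) z(3) g(2) by (meson le_add_left order.trans wb_le_trans)
  ultimately have "has_room x z''"
    using c(2) by (auto simp: has_room_def)
  moreover have "v1 \<le> z'" "w1 \<le> z'"
    using p1(1,2) z'(1) wb_trans wb_le by blast+
  moreover have "e0 \<le> z' + v1"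
    using vw1(3) \<open>w1 \<le> z'\<close> by (metis add.commute add_right_mono order.trans wb_le)
  moreover have "v1 \<le> u"
    using vw1(1) vw(2) ud(2) by (meson order.trans wb_le)
  then have "nmul n v1 \<le> x"
    using nu nmul_mono order.trans by blast
  moreover have "d2 \<le> infty ua"
    using d(1) b(1) ua(2) by (meson order.trans wb_le)
  ultimately show ?thesis
    using that[of z' z'' ua v1] z''(1) z'(2) wb_le by blast
qed

text \<open>An order-theoretic form of the equality of all functionals on \<open>w\<close> and \<open>x\<close>. It also
  controls functionals that are only defined on the strongly soft elements.\<close>

definition soft_replica :: "'a \<Rightarrow> 'a \<Rightarrow> bool" where
  "soft_replica w x \<longleftrightarrow> soft w \<and> w \<le> x \<and>
     (\<forall>x' k. x' \<lless> x \<longrightarrow> (\<exists>v. x' \<le> w + v \<and> nmul k v \<le> w + w))"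

lemma soft_replica_ex: obtains w where "soft_replica w x" "x \<le> infty w"
proof -
  obtain e where e: "incseq e" "lub e x" "\<And>k. e k \<lless> e (Suc k)" "\<And>k. e k \<lless> x"
    using wb_approx[of x] by blast
  define R where "R = (\<lambda>k (d, _::'a) (z, _::'a).
    (\<exists>s. d + s \<le> z \<and> d \<le> infty s) \<and> (\<exists>v. e k \<le> z + v \<and> v \<le> z \<and> nmul k v \<le> x))"
  have "\<exists>f. \<forall>k. (fst (f k) \<lless> snd (f k) \<and> has_room x (snd (f k))) \<and> R k (f k) (f (Suc k))"
  proof (rule dependent_nat_choice)
    \<comment> \<open>The start is 0, with all of \<open>x\<close> as room.\<close>
    show "\<exists>p. fst p \<lless> snd p \<and> has_room x (snd p)"
      by (intro exI[of _ "(0, 0)"]) (auto simp: has_room_def intro: exI[of _ x] le_infty)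
  next
    fix p :: "'a \<times> 'a" and k :: nat
    assume "fst p \<lless> snd p \<and> has_room x (snd p)"
    then have p: "fst p \<lless> snd p" "has_room x (snd p)" by simp_all
    obtain z' z s v where "z' \<lless> z" "has_room x z" "fst p + s \<le> z'" "fst p \<le> infty s"
      "e k \<le> z' + v" "v \<le> z'" "nmul k v \<le> x"
      using p e(4) by (rule has_room_step)
    then show "\<exists>p'. (fst p' \<lless> snd p' \<and> has_room x (snd p')) \<and> R k p p'"
      by (intro exI[of _ "(z', z)"]) (auto simp: R_def split: prod.splits)
  qed
  then obtain f where f: "\<And>k. fst (f k) \<lless> snd (f k)" "\<And>k. has_room x (snd (f k))"
    "\<And>k. R k (f k) (f (Suc k))"
    by blast
  define W where "W = (\<lambda>k. fst (f k))"
  have W1: "\<exists>s. W k + s \<le> W (Suc k) \<and> W k \<le> infty s" for k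
    using f(3)[of k] by (auto simp: R_def W_def split: prod.splits)
  have W2: "\<exists>v. e k \<le> W (Suc k) + v \<and> v \<le> W (Suc k) \<and> nmul k v \<le> x" for k
    using f(3)[of k] by (auto simp: R_def W_def split: prod.splits)
  have W3: "W k \<le> x" for k
    using f(1,2)[of k] by (auto simp: W_def has_room_def intro: wb_le wb_trans)
  have inc: "incseq W"
    using W1 by (auto simp: incseq_Suc_iff intro: order.trans[OF le_add_right])
  then obtain w where w: "lub W w"
    using lub_ex by blast
  have "soft w"
  proof (rule softI)
    fix z assume "z \<lless> w"
    then obtain k where k: "z \<le> W k"
      using wb_lubD inc w by blast
    obtain s where s: "W k + s \<le> W (Suc k)" "W k \<le> infty s"
      using W1 by blast
    have "z + s \<le> w"
      using k s(1) lub_upper[OF w] by (meson add_right_mono order.trans)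
    then show "\<exists>t. z + t \<le> w \<and> z \<le> infty t"
      using k s(2) order.trans by blast
  qed
  moreover have wx: "w \<le> x"
    using w W3 by (rule lub_least)
  \<comment> \<open>The errors lie below the stages, hence \<open>x \<le> w + w\<close>. This turns
    the bound \<open>nmul k v \<le> x\<close> into one by a soft element.\<close>
  moreover have xww: "x \<le> w + w"
    using e(2)
  proof (rule lub_least)
    fix k
    obtain v where v: "e k \<le> W (Suc k) + v" "v \<le> W (Suc k)"
      using W2 by blast
    then show "e k \<le> w + w"
      using lub_upper[OF w] by (meson add_mono order.trans)
  qed
  moreover have "\<exists>v. x' \<le> w + v \<and> nmul k v \<le> w + w" if x': "x' \<lless> x" for x' k
  proof -
    obtain m where "x' \<le> e m"
      using wb_lubD[OF x' e(1,2)] by blast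
    \<comment> \<open>The index must be large enough for the approximant to dominate
      \<open>x'\<close> and for at least \<open>k\<close> copies of the error to fit.\<close>
    then have m: "x' \<le> e (max m k)"
      using incseqD[OF e(1), of m "max m k"] by (auto intro: order.trans)
    obtain v where v: "e (max m k) \<le> W (Suc (max m k)) + v" "nmul (max m k) v \<le> x"
      using W2 by blast
    have "x' \<le> w + v"
      using m v(1) lub_upper[OF w] by (meson add_right_mono order.trans)
    moreover have "nmul k v \<le> w + w"
      using nmul_le_nmul[of k "max m k" v] v(2) xww by (auto intro: order.trans)
    ultimately show ?thesis by blast
  qed
  ultimately have "soft_replica w x"
    by (auto simp: soft_replica_def)
  moreover have "x \<le> infty w"
    using xww by (meson add_le_infty le_infty order.trans)
  ultimately show ?thesis
    using that by blast
qed

end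

section \<open>Functionals and the radius of comparison\<close>

text \<open>The case \<open>k = 1\<close> makes \<open>a\<close> finite when \<open>b\<close> is;
  for reals, \<open>k * (a - b)\<close> is bounded by \<open>2 * b\<close> for all \<open>k\<close>,
  so \<open>a - b\<close> cannot be positive.\<close>

lemma ennreal_le_by_multiples:
  fixes a b :: ennreal
  assumes "\<And>k::nat. of_nat k * a \<le> of_nat (k + 2) * b"
  shows "a \<le> b"
proof (cases "b = top")
  case False
  then obtain r where r: "b = ennreal r" "0 \<le> r"
    by (cases b) auto
  have "a \<le> of_nat 3 * b"
    using assms[of 1] by (simp add: eval_nat_numeral)
  also have "\<dots> < top"
    using r by (simp add: ennreal_mult_less_top)
  finally obtain s where s: "a = ennreal s" "0 \<le> s"
    by (cases a) auto
  have le: "real k * s \<le> real (k + 2) * r" for k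
    using assms[of k] r s
    unfolding ennreal_of_nat_eq_real_of_nat by (metis ennreal_le_iff ennreal_mult' mult_nonneg_nonneg of_nat_0_le_iff)
  have "s \<le> r"
  proof (rule ccontr)
    assume "\<not> s \<le> r"
    then obtain k :: nat where k: "2 * r < real k * (s - r)"
      using reals_Archimedean3[of "s - r"] by auto
    then show False
      using le[of k] by (simp add: algebra_simps)
  qed
  then show ?thesis
    using r s by (simp add: ennreal_leI)
qed simp

lemma functional_nmul:
  assumes "l \<in> functionals T" and "\<And>n. nmul n x \<in> T"
  shows "l (nmul n x) = of_nat n * l x"
proof (induction n)
  case 0
  then show ?case using assms(1) by (simp add: functionals_def)
next
  case (Suc n)
  have "x \<in> T"
    using assms(2)[of "Suc 0"] by simp
  then have "l (x + nmul n x) = l x + l (nmul n x)"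
    using assms by (simp add: functionals_def)
  then show ?case
    using Suc by (simp add: distrib_right)
qed

lemma functional_mono: "l \<in> functionals T \<Longrightarrow> x \<in> T \<Longrightarrow> y \<in> T \<Longrightarrow> x \<le> y \<Longrightarrow> l x \<le> l y"
  and functional_add: "l \<in> functionals T \<Longrightarrow> x \<in> T \<Longrightarrow> y \<in> T \<Longrightarrow> l (x + y) = l x + l y"
  and functional_lub:
    "l \<in> functionals T \<Longrightarrow> incseq_in T f \<Longrightarrow> lub_in T f s \<Longrightarrow> l s = (SUP n. l (f n))"
  by (simp_all add: functionals_def)

context cu_div
begin

section \<open>Approximation by soft elements\<close>

abbreviation "S_soft \<equiv> soft_part (UNIV :: 'a set)"

lemma mem_S_soft [simp]: "x \<in> S_soft \<longleftrightarrow> soft x"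
  by (simp add: soft_part_def soft_def)

text \<open>The witness \<open>t\<close> of softness need not be soft itself; a soft
  \<open>s\<close> below it that still dominates \<open>u'\<close> makes \<open>u' + s\<close>
  soft.\<close>

lemma soft_cofinal:
  assumes "soft u" "u' \<lless> u" obtains s where "soft s" "u' \<le> s" "s \<lless> u"
proof -
  obtain t where t: "u' + t \<lless> u" "u' \<lless> infty t"
    using assms by (rule softD)
  obtain s where s: "soft s" "s \<le> t" "u' \<lless> infty s"
    using t(2) by (rule soft_below)
  have "soft (u' + s)"
    using s(1) wb_le[OF s(3)] by (rule soft_add_dominated)
  moreover have "u' + s \<lless> u"
    using add_left_mono[OF s(2)] t(1) by (rule le_wb_trans)
  ultimately show ?thesis
    using that le_add_right by blast
qed

text \<open>A functional on the soft part is continuous only along sequences of soft elements, so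
  the approximants have to be soft as well.\<close>

lemma soft_approx:
  assumes "soft u" obtains f where "incseq f" "lub f u" "\<And>n. soft (f n)" "\<And>n. f n \<lless> u"
proof -
  obtain e where e: "incseq e" "lub e u" "\<And>k. e k \<lless> e (Suc k)" "\<And>k. e k \<lless> u"
    using wb_approx[of u] by blast
  have "\<exists>f. \<forall>n. (soft (f n) \<and> f n \<lless> u \<and> e n \<le> f n) \<and> f n \<le> f (Suc n)"
  proof (rule dependent_nat_choice)
    obtain s where "soft s" "e 0 \<le> s" "s \<lless> u"
      using assms e(4) by (rule soft_cofinal)
    then show "\<exists>s. soft s \<and> s \<lless> u \<and> e 0 \<le> s" by blast
  next
    fix s n assume "soft s \<and> s \<lless> u \<and> e n \<le> s"
    then have "s \<lless> u" by blast
    then obtain w where w: "s \<lless> w" "e (Suc n) \<lless> w" "w \<lless> u"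
      using e(4) by (rule wb_directed)
    obtain s' where s': "soft s'" "w \<le> s'" "s' \<lless> u"
      using assms w(3) by (rule soft_cofinal)
    have "s \<le> s'" "e (Suc n) \<le> s'"
      using w(1,2) s'(2) by (meson order.trans wb_le)+
    then show "\<exists>s'. (soft s' \<and> s' \<lless> u \<and> e (Suc n) \<le> s') \<and> s \<le> s'"
      using s' by blast
  qed
  then obtain f where f: "\<And>n. soft (f n)" "\<And>n. f n \<lless> u" "\<And>n. e n \<le> f n" "\<And>n. f n \<le> f (Suc n)"
    by blast
  have "lub f u"
  proof (rule lubI)
    show "f n \<le> u" for n using f(2) by (rule wb_le)
    show "u \<le> y" if "\<And>n. f n \<le> y" for y
      using e(2) by (rule lub_least) (meson f(3) that order.trans)
  qed
  then show ?thesis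
    using that f incseq_SucI by blast
qed

text \<open>The errors add up without loss of multiplicity. Additivity of \<open>extension\<close>
  rests on this.\<close>

lemma soft_replica_add:
  assumes "soft_replica w x" "soft_replica w' y" shows "soft_replica (w + w') (x + y)"
  unfolding soft_replica_def
proof (intro conjI allI impI)
  show "soft (w + w')" "w + w' \<le> x + y"
    using assms by (auto simp: soft_replica_def intro: soft_add add_mono)
  fix z k assume "z \<lless> x + y"
  then obtain x' y' where z: "x' \<lless> x" "y' \<lless> y" "z \<lless> x' + y'"
    by (rule wb_add_split)
  obtain v where v: "x' \<le> w + v" "nmul k v \<le> w + w"
    using assms(1) z(1) by (auto simp: soft_replica_def)
  obtain v' where v': "y' \<le> w' + v'" "nmul k v' \<le> w' + w'"
    using assms(2) z(2) by (auto simp: soft_replica_def)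
  have "z \<le> (w + v) + (w' + v')"
    using wb_le[OF z(3)] add_mono[OF v(1) v'(1)] by (rule order.trans)
  then have "z \<le> (w + w') + (v + v')"
    by (simp add: ac_simps)
  moreover have "nmul k (v + v') \<le> (w + w') + (w + w')"
    using add_mono[OF v(2) v'(2)] by (simp add: nmul_add_distrib ac_simps)
  ultimately show "\<exists>v. z \<le> w + w' + v \<and> nmul k v \<le> w + w' + (w + w')"
    by blast
qed

section \<open>Restriction and extension of functionals\<close>

lemma functional_restrict: assumes "l \<in> functionals UNIV" shows "l \<in> functionals S_soft"
  unfolding functionals_def
proof (intro CollectI conjI ballI allI impI)
  fix f s assume fs: "incseq_in S_soft f \<and> lub_in S_soft f s"
  then have "lub f s" "incseq_in UNIV f"
    using lub_soft_part by (auto simp: incseq_in_def)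
  then show "l s = (SUP n. l (f n))"
    using assms functional_lub by blast
qed (use assms in \<open>auto simp: functionals_def\<close>)

text \<open>In \<open>nmul k (e n) \<le> nmul k w + nmul k v\<close> the last term stays below
  \<open>w + w\<close> for every \<open>k\<close>, so division by \<open>k\<close> makes the error
  vanish.\<close>

lemma functional_soft_replica:
  assumes "soft_replica w x" "l \<in> functionals UNIV" shows "l w = l x"
proof (rule antisym)
  show "l w \<le> l x"
    using assms by (auto simp: soft_replica_def intro: functional_mono)
  obtain e where e: "incseq e" "lub e x" "\<And>k. e k \<lless> e (Suc k)" "\<And>k. e k \<lless> x"
    using wb_approx[of x] by blast
  have "l (e n) \<le> l w" for n
  proof (rule ennreal_le_by_multiples)
    fix k :: nat
    obtain v where v: "e n \<le> w + v" "nmul k v \<le> w + w"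
      using assms(1) e(4) unfolding soft_replica_def by blast
    have "nmul k (e n) \<le> nmul k w + nmul k v"
      using nmul_mono[OF v(1)] by (simp add: nmul_add_distrib)
    also have "\<dots> \<le> nmul k w + (w + w)"
      using v(2) by (rule add_left_mono)
    also have "\<dots> = nmul (k + 2) w"
      by (simp add: nmul_add eval_nat_numeral ac_simps)
    finally have "l (nmul k (e n)) \<le> l (nmul (k + 2) w)"
      using assms(2) by (auto intro: functional_mono)
    then show "of_nat k * l (e n) \<le> of_nat (k + 2) * l w"
      by (simp only: functional_nmul[OF assms(2) UNIV_I])
  qed
  then show "l x \<le> l w"
    using functional_lub[OF assms(2) _ e(2)] e(1) by (simp add: incseq_in_UNIV SUP_le_iff)
qed

text \<open>The same estimate for soft approximants of \<open>u\<close>: only multiples of these and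
  of \<open>w\<close> are evaluated, never the error \<open>v\<close>, which may fail to be
  soft.\<close>

lemma soft_functional_le_replica:
  assumes "soft_replica w x" "l \<in> functionals S_soft" "soft u" "u \<le> x" shows "l u \<le> l w"
proof -
  have sw: "soft w"
    using assms(1) by (simp add: soft_replica_def)
  obtain e where e: "incseq e" "lub e u" "\<And>n. soft (e n)" "\<And>n. e n \<lless> u"
    using soft_approx[OF assms(3)] by blast
  have "l (e n) \<le> l w" for n
  proof (rule ennreal_le_by_multiples)
    fix k :: nat
    have ex: "e n \<lless> x"
      using e(4) assms(4) by (rule wb_le_trans)
    obtain v where v: "e n \<le> w + v" "nmul k v \<le> w + w"
      using assms(1) ex unfolding soft_replica_def by blast
    have "nmul k (e n) \<le> nmul k w + nmul k v"
      using nmul_mono[OF v(1)] by (simp add: nmul_add_distrib)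
    also have "\<dots> \<le> nmul k w + (w + w)"
      using v(2) by (rule add_left_mono)
    also have "\<dots> = nmul (k + 2) w"
      by (simp add: nmul_add eval_nat_numeral ac_simps)
    finally have "l (nmul k (e n)) \<le> l (nmul (k + 2) w)"
      using assms(2) e(3) sw by (auto intro!: functional_mono[of l S_soft] soft_nmul soft_add)
    then show "of_nat k * l (e n) \<le> of_nat (k + 2) * l w"
      by (simp only: functional_nmul[OF assms(2)] mem_S_soft soft_nmul e(3) sw)
  qed
  moreover have "incseq_in S_soft e"
    using e(1,3) by (auto simp: incseq_in_def incseq_Suc_iff)
  then have "l u = (SUP n. l (e n))"
    using functional_lub[OF assms(2)] lub_soft_part e(2) by blast
  ultimately show ?thesis
    by (simp add: SUP_le_iff)
qed

text \<open>The supremum avoids a choice of replicas and makes monotonicity immediate; it is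
  attained at every soft replica of \<open>x\<close>.\<close>

definition extension :: "('a \<Rightarrow> ennreal) \<Rightarrow> 'a \<Rightarrow> ennreal" where
  "extension l x = (SUP u\<in>{u. soft u \<and> u \<le> x}. l u)"

lemma extension_soft: assumes "l \<in> functionals S_soft" "soft x" shows "extension l x = l x"
  unfolding extension_def
  using assms by (intro antisym SUP_least SUP_upper) (auto intro: functional_mono)

lemma extension_replica:
  assumes "l \<in> functionals S_soft" "soft_replica w x" shows "extension l x = l w"
  unfolding extension_def
proof (intro antisym SUP_least SUP_upper)
  show "l u \<le> l w" if "u \<in> {u. soft u \<and> u \<le> x}" for u
    using that assms soft_functional_le_replica by blast
qed (use assms in \<open>auto simp: soft_replica_def\<close>)

lemma extension_functional: assumes l: "l \<in> functionals S_soft" shows "extension l \<in> functionals UNIV"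
  unfolding functionals_def
proof (intro CollectI conjI ballI allI impI)
  show "extension l 0 = 0"
    using extension_soft[OF l soft_zero] l by (simp add: functionals_def)
  show mono: "extension l x \<le> extension l y" if "x \<le> y" for x y
    unfolding extension_def using that by (intro SUP_subset_mono) (auto intro: order.trans)
  show "extension l (x + y) = extension l x + extension l y" for x y
  proof -
    obtain w where w: "soft_replica w x" by (rule soft_replica_ex)
    obtain w' where w': "soft_replica w' y" by (rule soft_replica_ex)
    have "extension l (x + y) = l (w + w')"
      using l soft_replica_add[OF w w'] by (rule extension_replica)
    also have "\<dots> = l w + l w'"
      using w w' by (intro functional_add[OF l]) (auto simp: soft_replica_def)
    finally show ?thesis
      using extension_replica[OF l w] extension_replica[OF l w'] by simp
  qed
  fix f s assume "incseq_in UNIV f \<and> lub f s"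
  then have f: "incseq f" "lub f s"
    by (simp_all add: incseq_in_UNIV)
  show "extension l s = (SUP n. extension l (f n))"
  proof (rule antisym)
    show "(SUP n. extension l (f n)) \<le> extension l s"
      using f by (intro SUP_least mono) (auto intro: lub_upper)
    \<comment> \<open>A soft element way below \<open>u\<close> is already below some
      \<open>f m\<close>, where the supremum defining \<open>extension\<close> counts it.\<close>
    have "l u \<le> (SUP n. extension l (f n))" if u: "soft u" "u \<le> s" for u
    proof -
      obtain e where e: "incseq e" "lub e u" "\<And>n. soft (e n)" "\<And>n. e n \<lless> u"
        using soft_approx[OF u(1)] by blast
      have "l (e n) \<le> (SUP n. extension l (f n))" for n
      proof -
        obtain m where m: "e n \<le> f m"
          using wb_lubD[OF e(4) f u(2)] by blast
        have "l (e n) \<le> extension l (f m)"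
          unfolding extension_def using e(3) m by (intro SUP_upper) auto
        also have "\<dots> \<le> (SUP n. extension l (f n))"
          by (rule SUP_upper) simp
        finally show ?thesis .
      qed
      moreover have "incseq_in S_soft e"
        using e(1,3) by (auto simp: incseq_in_def incseq_Suc_iff)
      then have "l u = (SUP n. l (e n))"
        using functional_lub[OF l] lub_soft_part e(2) by blast
      ultimately show ?thesis
        by (simp add: SUP_le_iff)
    qed
    then show "extension l s \<le> (SUP n. extension l (f n))"
      unfolding extension_def[of l s] by (intro SUP_least) auto
  qed
qed

section \<open>Comparison in \<open>S\<close> and in its soft part\<close>

lemma R1_soft_part:
  assumes "soft_replica w e" "R1 UNIV e r" shows "R1 S_soft w r"
  unfolding R1_def
proof (intro ballI impI)
  fix x y assume le: "\<forall>l\<in>functionals S_soft. l x + ennreal r * l w \<le> l y"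
  have "l x + ennreal r * l e \<le> l y" if "l \<in> functionals UNIV" for l
    using le functional_restrict[OF that] functional_soft_replica[OF assms(1) that] by auto
  then show "x \<le> y"
    using assms(2) by (auto simp: R1_def)
qed

lemma R1_of_soft_part:
  assumes w: "soft_replica w e" and full: "\<And>x. x \<le> infty e"
    and R1: "R1 S_soft w r" and r: "0 < r" "0 < \<epsilon>"
  shows "R1 UNIV e (r + \<epsilon>)"
  unfolding R1_def
proof (intro ballI impI)
  fix x y assume le: "\<forall>l\<in>functionals UNIV. l x + ennreal (r + \<epsilon>) * l e \<le> l y"
  \<comment> \<open>This makes \<open>1/n\<close> smaller than \<open>\<epsilon>\<close>, so that
    \<open>nmul n v \<le> e\<close> bounds the value at \<open>v\<close> by
    \<open>\<epsilon>\<close> times the value at \<open>e\<close>.\<close>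
  obtain n :: nat where n: "1 < real n * \<epsilon>"
    using reals_Archimedean3[OF r(2)] by blast
  then have "n > 0"
    by (cases n) auto
  then obtain v where v: "soft v" "nmul n v \<le> e" "e \<le> infty v"
    by (rule soft_fraction)
  have soft_xv: "soft (x + v)"
    using v(1) le_infty_trans[OF full v(3)] by (rule soft_add_dominated)
  obtain y' where y': "soft_replica y' y"
    by (rule soft_replica_ex)
  \<comment> \<open>The hypothesis on \<open>x\<close> and \<open>y\<close> speaks of functionals on
    \<open>S\<close>, so a functional on the soft part is tested through its extension.\<close>
  have "l (x + v) + ennreal r * l w \<le> l y'" if l: "l \<in> functionals S_soft" for l
  proof -
    let ?l = "extension l"
    have L: "?l \<in> functionals UNIV"
      using l by (rule extension_functional)
    have "?l v \<le> ennreal (real n * \<epsilon>) * ?l v"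
      using n mult_right_mono[of 1 "ennreal (real n * \<epsilon>)" "?l v"] by simp
    also have "\<dots> = ennreal \<epsilon> * (of_nat n * ?l v)"
      using r by (simp add: ennreal_mult ennreal_of_nat_eq_real_of_nat mult_ac)
    also have "\<dots> = ennreal \<epsilon> * ?l (nmul n v)"
      using functional_nmul[OF L] by simp
    also have "\<dots> \<le> ennreal \<epsilon> * ?l e"
      using v(2) by (intro mult_left_mono functional_mono[OF L]) auto
    finally have lv: "?l v \<le> ennreal \<epsilon> * ?l e" .
    have "?l (x + v) + ennreal r * ?l w = ?l x + ?l v + ennreal r * ?l e"
      using functional_add[OF L, of x v] functional_soft_replica[OF w L] by simp
    also have "\<dots> \<le> ?l x + ennreal \<epsilon> * ?l e + ennreal r * ?l e"
      using lv by (intro add_mono) auto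
    also have "\<dots> = ?l x + ennreal (r + \<epsilon>) * ?l e"
      using r by (simp add: distrib_left mult.commute add.assoc)
    also have "\<dots> \<le> ?l y"
      using le L by blast
    also have "\<dots> = ?l y'"
      using functional_soft_replica[OF y' L] by simp
    finally show ?thesis
      using soft_xv w y' by (simp add: extension_soft[OF l] soft_replica_def)
  qed
  then have "x + v \<le> y'"
    using R1 soft_xv y' by (auto simp: R1_def soft_replica_def)
  then show "x \<le> y"
    using y' le_add_right[of x v] by (auto simp: soft_replica_def intro: order.trans)
qed

lemma rc_soft_replica:
  assumes "soft_replica w e" "\<And>x. x \<le> infty e" shows "rc UNIV e = rc S_soft w"
proof (rule antisym)
  show "rc S_soft w \<le> rc UNIV e"
    unfolding rc_def using R1_soft_part[OF assms(1)] by (intro Inf_superset_mono) auto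
  show "rc UNIV e \<le> rc S_soft w"
    unfolding rc_def[of S_soft]
  proof (rule Inf_greatest)
    fix q assume "q \<in> {ennreal r |r. 0 < r \<and> R1 S_soft w r}"
    then obtain r where r: "q = ennreal r" "0 < r" "R1 S_soft w r"
      by blast
    have "rc UNIV e \<le> ennreal r + ennreal \<epsilon>" if "0 < \<epsilon>" for \<epsilon>
    proof -
      have "R1 UNIV e (r + \<epsilon>)"
        using assms r(3,2) that by (rule R1_of_soft_part)
      then have "rc UNIV e \<le> ennreal (r + \<epsilon>)"
        unfolding rc_def using r(2) that by (intro Inf_lower CollectI exI[of _ "r + \<epsilon>"]) auto
      then show ?thesis
        using r(2) that by simp
    qed
    then show "rc UNIV e \<le> q"
      unfolding r(1) by (rule ennreal_le_epsilon)
  qed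
qed

end

section \<open>The largest soft element\<close>

context cu_div
begin

text \<open>O6 cuts off the part of \<open>x\<close> below one copy of \<open>y\<close>; O7
  amalgamates it, inside that same \<open>y\<close>, with the piece found by induction for the other
  copies.\<close>

lemma common_piece:
  "x' \<lless> x \<Longrightarrow> x \<le> nmul n y \<Longrightarrow> \<exists>z. z \<le> y \<and> z \<le> nmul n x \<and> x' \<le> nmul n z"
proof (induction n arbitrary: x' x)
  case 0
  then have "x' \<le> 0"
    using wb_le order.trans by fastforce
  then show ?case
    by (intro exI[of _ 0]) simp
next
  case (Suc n)
  obtain x'' where x'': "x' \<lless> x''" "x'' \<lless> x"
    using Suc.prems(1) by (rule wb_interpolate)
  have "x \<le> y + nmul n y"
    using Suc.prems(2) by simp
  then obtain v w where vw: "v \<le> x" "v \<le> y" "w \<le> x" "w \<le> nmul n y" "x'' \<le> v + w"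
    using O6E[OF x''(2)] by blast
  obtain v' w' where vw': "v' \<lless> v" "w' \<lless> w" "x' \<lless> v' + w'"
    using wb_le_trans[OF x''(1) vw(5)] by (rule wb_add_split)
  obtain w'' where w'': "w' \<lless> w''" "w'' \<lless> w"
    using vw'(2) by (rule wb_interpolate)
  obtain z1 where z1: "z1 \<le> y" "z1 \<le> nmul n w" "w'' \<le> nmul n z1"
    using Suc.IH[OF w''(2) vw(4)] by blast
  obtain z1' where z1': "z1' \<lless> z1" "w' \<lless> nmul n z1'"
    using wb_le_trans[OF w''(1) z1(3)] by (rule wb_nmul_split)
  obtain z where z: "v' \<lless> z" "z1' \<lless> z" "z \<le> y" "z \<le> v + z1"
    using vw'(1) vw(2) z1'(1) z1(1) by (rule O7E)
  have "z \<le> x + nmul n x"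
    using z(4) add_mono[OF vw(1) order.trans[OF z1(2) nmul_mono[OF vw(3)]]] by (rule order.trans)
  moreover have "w' \<le> nmul n z"
    using wb_le[OF z1'(2)] nmul_mono[OF wb_le[OF z(2)]] by (rule order.trans)
  then have "x' \<le> z + nmul n z"
    using order.trans[OF wb_le[OF vw'(3)] add_mono[OF wb_le[OF z(1)]]] by blast
  ultimately show ?case
    using z(3) by (intro exI[of _ z]) simp
qed

text \<open>The number \<open>m\<close> of pieces needed to cover \<open>z\<close> by \<open>t\<close> is fixed before \<open>z\<close> is divided by
  \<open>m\<close>; therefore the pieces of a fraction of \<open>z\<close> still add up to something below \<open>z\<close>.\<close>

lemma ideal_filtered:
  assumes "q' \<lless> q" "q \<le> infty s" "q \<le> infty t"
  obtains u where "u \<le> s" "u \<le> t" "q' \<lless> infty u"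
proof -
  obtain q1 where q1: "q' \<lless> q1" "q1 \<lless> q"
    using assms(1) by (rule wb_interpolate)
  obtain q2 where q2: "q1 \<lless> q2" "q2 \<lless> q"
    using q1(2) by (rule wb_interpolate)
  obtain n where n: "q2 \<le> nmul n s"
    using wb_le_trans[OF q2(2) assms(2)] by (rule wb_infty_nmul)
  obtain k where k: "q2 \<le> nmul k t"
    using wb_le_trans[OF q2(2) assms(3)] by (rule wb_infty_nmul)
  \<comment> \<open>The bound by copies of \<open>q2\<close> puts \<open>z\<close> below a multiple
    of \<open>t\<close> as well, so a second application can move a fraction of \<open>z\<close>
    below \<open>t\<close>.\<close>
  obtain z where z: "z \<le> s" "z \<le> nmul n q2" "q1 \<le> nmul n z"
    using common_piece[OF q2(1) n] by blast
  define m where "m = Suc (n * k)"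
  have "z \<le> nmul (n * k) t"
    using order.trans[OF z(2) nmul_mono[OF k]] by (simp add: nmul_mult)
  then have zt: "z \<le> nmul m t"
    unfolding m_def by (meson nmul_le_nmul le_SucI order.refl order.trans)
  have "q' \<lless> infty z"
    using wb_le_trans[OF q1(1) order.trans[OF z(3) nmul_le_infty]] .
  then obtain y where y: "nmul m y \<le> z" "q' \<lless> infty y"
    by (rule divide_wbE)
  have "y \<le> nmul m y"
    unfolding m_def by (simp add: le_add_right)
  then have yt: "y \<le> nmul m t"
    using y(1) zt by (meson order.trans)
  obtain y' where y': "y' \<lless> y" "q' \<lless> infty y'"
    using y(2) by (rule wb_inftyE)
  obtain u where u: "u \<le> t" "u \<le> nmul m y" "y' \<le> nmul m u"
    using common_piece[OF y'(1) yt] by blast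
  have "u \<le> s"
    using order.trans[OF u(2) order.trans[OF y(1) z(1)]] .
  moreover have "q' \<lless> infty u"
    using wb_le_trans[OF y'(2) infty_le_infty[OF order.trans[OF u(3) nmul_le_infty]]] .
  ultimately show ?thesis
    using that u(1) by blast
qed

text \<open>Softness of \<open>a\<close> leaves room \<open>t\<close> beyond \<open>a1\<close>, so
  O5 yields a complement \<open>c\<close> with \<open>a1\<close> in its ideal; then
  \<open>e \<le> a1 + c\<close> makes \<open>c\<close> full in \<open>e\<close>. A soft element
  generating the ideal of \<open>c\<close> is added to \<open>a0\<close>.\<close>

lemma soft_enlarge_full:
  assumes "soft a" "a \<le> e" "a0 \<lless> a"
  obtains b where "soft b" "a0 \<le> b" "b \<le> e" "e \<le> infty b"
proof -
  obtain a1 where a1: "a0 \<lless> a1" "a1 \<lless> a"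
    using assms(3) by (rule wb_interpolate)
  obtain t where t: "a1 + t \<lless> a" "a1 \<lless> infty t"
    using assms(1) a1(2) by (rule softD)
  obtain t' where t': "t' \<lless> t" "a1 \<lless> infty t'"
    using t(2) by (rule wb_inftyE)
  obtain c where c: "t' \<lless> c" "a0 + c \<le> e" "e \<le> a1 + c"
    using order.trans[OF wb_le[OF t(1)] assms(2)] a1(1) t'(1) by (rule O5E)
  have a1c: "a1 \<le> infty c"
    using order.trans[OF wb_le[OF t'(2)] infty_mono[OF wb_le[OF c(1)]]] .
  obtain s where s: "soft s" "nmul 1 s \<le> c" "c \<le> infty s"
    using soft_fraction[of 1 c] by auto
  have a1s: "a1 \<le> infty s"
    using a1c s(3) by (rule le_infty_trans)
  have "soft (a0 + s)"
    using s(1) order.trans[OF wb_le[OF a1(1)] a1s] by (rule soft_add_dominated)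
  moreover have "a0 + s \<le> e"
    using order.trans[OF add_left_mono c(2)] s(2) by simp
  moreover have "e \<le> infty s"
    using order.trans[OF c(3) add_le_infty[OF a1s s(3)]] .
  then have "e \<le> infty (a0 + s)"
    using order.trans[OF _ infty_mono[OF le_add_left]] by blast
  ultimately show ?thesis
    using that le_add_right by blast
qed

text \<open>The gap \<open>t\<close> will hold the piece that separativity cancels. Softness puts
  \<open>b\<close> into the ideal of \<open>t\<close>, and \<open>b\<close> is chosen large enough
  to have \<open>Q\<close> in its own ideal.\<close>

lemma soft_interpolate_full:
  assumes "soft a" "a' \<lless> a" "Q \<lless> infty a"
  obtains b t where "soft b" "a' \<le> b" "b + t \<lless> a" "Q \<lless> infty b" "Q \<lless> infty t"
proof -
  obtain c where c: "c \<lless> a" "Q \<lless> infty c"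
    using assms(3) by (rule wb_inftyE)
  obtain d where d: "a' \<lless> d" "c \<lless> d" "d \<lless> a"
    using assms(2) c(1) by (rule wb_directed)
  obtain b where b: "soft b" "d \<le> b" "b \<lless> a"
    using assms(1) d(3) by (rule soft_cofinal)
  obtain t where t: "b + t \<lless> a" "b \<lless> infty t"
    using assms(1) b(3) by (rule softD)
  have Qb: "Q \<lless> infty b"
    using wb_le_trans[OF c(2) infty_mono[OF order.trans[OF wb_le[OF d(2)] b(2)]]] .
  have "Q \<lless> infty t"
    using wb_le_trans[OF Qb infty_le_infty[OF wb_le[OF t(2)]]] .
  moreover have "a' \<le> b"
    using order.trans[OF wb_le[OF d(1)] b(2)] .
  ultimately show ?thesis
    using that b(1) t(1) Qb by blast
qed

lemma soft_join_full:
  assumes sep: "left_soft_separative (UNIV :: 'a set)"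
    and a: "soft a" "a \<le> e" "e \<le> infty a" "a0 \<lless> a"
    and b: "soft b" "b \<le> e" "e \<le> infty b" "b0 \<lless> b"
  obtains z where "soft z" "z \<le> e" "a0 \<lless> z" "b0 \<lless> z"
proof -
  have sepD: "x \<lless> y" if "soft x" "x + t \<lless> y + t" "t \<lless> infty x" "t \<lless> infty y" for x y t
    using sep that unfolding left_soft_separative_def wb_eq infty_eq
    by (meson UNIV_I mem_S_soft)
  obtain a1 where a1: "a0 \<lless> a1" "a1 \<lless> a"
    using a(4) by (rule wb_interpolate)
  obtain a2 where a2: "a1 \<lless> a2" "a2 \<lless> a"
    using a1(2) by (rule wb_interpolate)
  obtain b1 where b1: "b0 \<lless> b1" "b1 \<lless> b"
    using b(4) by (rule wb_interpolate)
  obtain b2 where b2: "b1 \<lless> b2" "b2 \<lless> b"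
    using b1(2) by (rule wb_interpolate)
  let ?Q = "a2 + b2"
  have Q: "?Q \<lless> a + b"
    using a2(2) b2(2) by (rule wb_add)
  \<comment> \<open>Fullness puts \<open>?Q\<close> into both ideals, so that one piece can be found
    inside \<open>a3\<close>, \<open>b3\<close> and both gaps.\<close>
  have "a + b \<le> infty a" "a + b \<le> infty b"
    using a(2,3) b(2,3) by (meson add_le_infty le_infty order.trans)+
  then have "?Q \<lless> infty a" "?Q \<lless> infty b"
    using Q wb_le_trans by blast+
  then obtain a3 ta b3 tb
    where a3: "soft a3" "a2 \<le> a3" "a3 + ta \<lless> a" "?Q \<lless> infty a3" "?Q \<lless> infty ta"
      and b3: "soft b3" "b2 \<le> b3" "b3 + tb \<lless> b" "?Q \<lless> infty b3" "?Q \<lless> infty tb"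
    using soft_interpolate_full[OF a(1) a2(2), of ?Q] soft_interpolate_full[OF b(1) b2(2), of ?Q]
    by metis
  obtain q1 where q1: "a1 + b1 \<lless> q1" "q1 \<lless> ?Q"
    using wb_add[OF a2(1) b2(1)] by (rule wb_interpolate)
  obtain q2 where q2: "q1 \<lless> q2" "q2 \<lless> ?Q"
    using q1(2) by (rule wb_interpolate)
  obtain q3 where q3: "q2 \<lless> q3" "q3 \<lless> ?Q"
    using q2(2) by (rule wb_interpolate)
  \<comment> \<open>Three intersections of ideals produce \<open>u\<close> below \<open>ta\<close>,
    \<open>tb\<close>, \<open>a3\<close> and \<open>b3\<close>; each costs one step in the chain
    below \<open>?Q\<close>.\<close>
  obtain u1 where u1: "u1 \<le> ta" "u1 \<le> tb" "q3 \<lless> infty u1"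
    using q3(2) wb_le[OF a3(5)] wb_le[OF b3(5)] by (rule ideal_filtered)
  have "q3 \<le> infty a3" "q2 \<le> infty b3"
    using q2(2) q3(2) a3(4) b3(4) wb_trans wb_le by blast+
  obtain u2 where u2: "u2 \<le> u1" "u2 \<le> a3" "q2 \<lless> infty u2"
    using q3(1) wb_le[OF u1(3)] \<open>q3 \<le> infty a3\<close> by (rule ideal_filtered)
  obtain u where u: "u \<le> u2" "u \<le> b3" "q1 \<lless> infty u"
    using q2(1) wb_le[OF u2(3)] \<open>q2 \<le> infty b3\<close> by (rule ideal_filtered)
  have u_le: "u \<le> ta" "u \<le> tb" "u \<le> a3"
    using u u1 u2 by (meson order.trans)+
  \<comment> \<open>Only about half of \<open>u\<close> is removed from \<open>e\<close>: then the
    complement \<open>g\<close> can be chosen above \<open>y''\<close>, as separativity will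
    require.\<close>
  obtain y where y: "y + y \<le> u" "q1 \<lless> infty y"
    using u(3) by (rule halve_wbE)
  obtain y' where y': "y' \<lless> y" "q1 \<lless> infty y'"
    using y(2) by (rule wb_inftyE)
  obtain y'' where y'': "y' \<lless> y''" "y'' \<lless> y"
    using y'(1) by (rule wb_interpolate)
  have a3a: "a3 \<le> a"
    using le_add_right wb_le[OF a3(3)] by (rule order.trans)
  have "y + y \<le> e"
    using y(1) u_le(3) a3a a(2) by (meson order.trans)
  then obtain g where g: "y' + g \<le> e" "e \<le> y'' + g" "y'' \<lless> g"
    using y'' by (rule complementE)
  have yu: "y'' \<lless> u"
    using y''(2) y(1) le_add_right by (meson order.trans wb_le_trans)
  have yg: "y'' \<lless> infty g"
    using g(3) le_infty by (rule wb_le_trans)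
  \<comment> \<open>\<open>y''\<close> fits into the gap \<open>t\<close>, and
    \<open>e \<le> y'' + g\<close>; hence \<open>c + y'' \<lless> g + y''\<close>. As
    \<open>y''\<close> is in the ideals of \<open>c\<close> and \<open>g\<close>, it
    cancels.\<close>
  have cancel: "c \<lless> g" if "soft c" "c + t \<lless> d" "d \<le> e" "u \<le> t" "u \<le> c" for c d t
  proof (rule sepD)
    have "c + y'' \<le> c + t"
      using yu that(4) by (meson add_left_mono order.trans wb_le)
    moreover have "d \<le> g + y''"
      using that(3) g(2) by (metis add.commute order.trans)
    ultimately show "c + y'' \<lless> g + y''"
      using that(2) wb_mono by blast
    show "y'' \<lless> infty c"
      using yu that(5) le_infty by (meson order.trans wb_le_trans)
  qed (use that(1) yg in auto)
  have "a3 \<lless> g" "b3 \<lless> g"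
    using cancel[OF a3(1,3) a(2) u_le(1,3)] cancel[OF b3(1,3) b(2) u_le(2) u(2)] .
  then have "a1 \<le> g" "b1 \<le> g"
    using a2(1) a3(2) b2(1) b3(2) by (meson order.trans wb_le)+
  \<comment> \<open>The bound \<open>z \<le> a1 + b1\<close> keeps \<open>z\<close> in the ideal of
    \<open>y'\<close>.\<close>
  then obtain z where z: "a0 \<lless> z" "b0 \<lless> z" "z \<le> g" "z \<le> a1 + b1"
    using O7E[OF a1(1) _ b1(1)] by blast
  obtain z' where z': "a0 \<lless> z'" "b0 \<lless> z'" "z' \<lless> z"
    using z(1,2) by (rule wb_directed)
  have "z \<le> infty y'"
    using z(4) q1(1) y'(2) by (meson order.trans wb_le)
  then have "z' \<lless> infty y'"
    using z'(3) wb_le_trans by blast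
  \<comment> \<open>\<open>y'\<close> was kept free beside \<open>g\<close>; a soft part of it that
    dominates \<open>z'\<close> makes the sum soft without leaving \<open>e\<close>.\<close>
  then obtain s where s: "soft s" "s \<le> y'" "z' \<lless> infty s"
    by (rule soft_below)
  have "soft (z' + s)"
    using s(1) wb_le[OF s(3)] by (rule soft_add_dominated)
  moreover have "s + z' \<le> y' + g"
    using s(2) order.trans[OF wb_le[OF z'(3)] z(3)] by (rule add_mono)
  then have "z' + s \<le> e"
    using g(1) by (metis add.commute order.trans)
  moreover have "a0 \<lless> z' + s" "b0 \<lless> z' + s"
    using z'(1,2) le_add_right wb_le_trans by blast+
  ultimately show ?thesis
    using that by blast
qed

text \<open>\<open>soft_enlarge_full\<close> reduces this to the full case; the interpolants
  \<open>a1\<close> and \<open>b1\<close> absorb its loss.\<close>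

lemma soft_join:
  assumes sep: "left_soft_separative (UNIV :: 'a set)"
    and a: "soft a" "a \<le> e" "a0 \<lless> a" and b: "soft b" "b \<le> e" "b0 \<lless> b"
  obtains z where "soft z" "z \<le> e" "a0 \<lless> z" "b0 \<lless> z"
proof -
  obtain a1 where a1: "a0 \<lless> a1" "a1 \<lless> a"
    using a(3) by (rule wb_interpolate)
  obtain b1 where b1: "b0 \<lless> b1" "b1 \<lless> b"
    using b(3) by (rule wb_interpolate)
  obtain c where c: "soft c" "a1 \<le> c" "c \<le> e" "e \<le> infty c"
    using a(1,2) a1(2) by (rule soft_enlarge_full)
  obtain d where d: "soft d" "b1 \<le> d" "d \<le> e" "e \<le> infty d"
    using b(1,2) b1(2) by (rule soft_enlarge_full)
  show ?thesis
    using soft_join_full[OF sep c(1,3,4) wb_le_trans[OF a1(1) c(2)] d(1,3,4) wb_le_trans[OF b1(1) d(2)]]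
      that by blast
qed

text \<open>Members of a base below \<open>x\<close> need not be way below \<open>x\<close>, so each
  of them is replaced by a sequence approximating it.\<close>

lemma countable_wb_base:
  assumes "countably_based (UNIV :: 'a set)"
  obtains C where "countable C" "\<And>x' x. x' \<lless> x \<Longrightarrow> \<exists>c\<in>C. x' \<le> c \<and> c \<lless> x"
proof -
  obtain B :: "'a set" where B: "countable B" "\<And>x. \<exists>f. (\<forall>n. f n \<in> B) \<and> incseq f \<and> lub f x"
    using assms unfolding countably_based_def by (auto simp: incseq_in_UNIV)
  have "\<forall>c. \<exists>h. incseq h \<and> lub h c \<and> (\<forall>n. h n \<lless> c)"
    using wb_approx by metis
  then obtain H where H: "\<And>c. incseq (H c)" "\<And>c. lub (H c) c" "\<And>c n. H c n \<lless> c"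
    by metis
  show ?thesis
  proof
    show "countable (\<Union>c\<in>B. range (H c))"
      using B(1) by simp
    fix x' x assume "x' \<lless> x"
    then obtain x'' where x'': "x' \<lless> x''" "x'' \<lless> x"
      by (rule wb_interpolate)
    obtain f where f: "\<And>n. f n \<in> B" "incseq f" "lub f x"
      using B(2) by blast
    obtain n where n: "x'' \<le> f n"
      using wb_lubD[OF x''(2) f(2,3)] by blast
    obtain m where m: "x' \<le> H (f n) m"
      using wb_lubD[OF wb_le_trans[OF x''(1) n] H(1,2)] by blast
    have "H (f n) m \<lless> x"
      using H(3) lub_upper[OF f(3)] by (rule wb_le_trans)
    then show "\<exists>c\<in>\<Union>c\<in>B. range (H c). x' \<le> c \<and> c \<lless> x"
      using m f(1) by blast
  qed
qed

text \<open>Countably many base elements detect all soft elements below \<open>e\<close>;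
  \<open>soft_join\<close> provides an increasing sequence of soft elements dominating them.\<close>

lemma largest_soft_below:
  assumes cb: "countably_based (UNIV :: 'a set)" and sep: "left_soft_separative (UNIV :: 'a set)"
  obtains s where "soft s" "s \<le> e" "\<And>v. soft v \<Longrightarrow> v \<le> e \<Longrightarrow> v \<le> s"
proof -
  obtain C where C: "countable C" "\<And>x' x. x' \<lless> x \<Longrightarrow> \<exists>c\<in>C. x' \<le> c \<and> c \<lless> x"
    using countable_wb_base[OF cb] by blast
  define D where "D = {c \<in> C. \<exists>a. soft a \<and> a \<le> e \<and> c \<lless> a}"
  obtain c0 where "c0 \<in> C" "c0 \<lless> 0"
    using C(2)[of 0 0] by auto
  then have "D \<noteq> {}"
    unfolding D_def using soft_zero zero_least[of e] by blast
  moreover have "countable D"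
    using C(1) by (simp add: D_def)
  ultimately obtain d :: "nat \<Rightarrow> 'a" where d: "range d = D"
    using range_from_nat_into[of D] by blast
  have dD: "\<exists>a. soft a \<and> a \<le> e \<and> d n \<lless> a" for n
    using d by (auto simp: D_def)
  \<comment> \<open>Each \<open>f n\<close> is kept way below a soft element under \<open>e\<close>,
    since being below \<open>e\<close> alone would not allow the next join.\<close>
  have "\<exists>f. \<forall>n. (soft (f n) \<and> (\<exists>z. soft z \<and> z \<le> e \<and> f n \<lless> z) \<and> d n \<le> f n) \<and> f n \<le> f (Suc n)"
  proof (rule dependent_nat_choice)
    obtain a where a: "soft a" "a \<le> e" "d 0 \<lless> a"
      using dD by blast
    obtain s where "soft s" "d 0 \<le> s" "s \<lless> a"
      using a(1,3) by (rule soft_cofinal)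
    then show "\<exists>x. soft x \<and> (\<exists>z. soft z \<and> z \<le> e \<and> x \<lless> z) \<and> d 0 \<le> x"
      using a by blast
  next
    fix x n assume "soft x \<and> (\<exists>z. soft z \<and> z \<le> e \<and> x \<lless> z) \<and> d n \<le> x"
    then obtain z where z: "soft z" "z \<le> e" "x \<lless> z"
      by blast
    obtain a where a: "soft a" "a \<le> e" "d (Suc n) \<lless> a"
      using dD by blast
    obtain y where y: "soft y" "y \<le> e" "x \<lless> y" "d (Suc n) \<lless> y"
      using sep z a by (rule soft_join)
    obtain w where w: "x \<lless> w" "d (Suc n) \<lless> w" "w \<lless> y"
      using y(3,4) by (rule wb_directed)
    obtain s where s: "soft s" "w \<le> s" "s \<lless> y"
      using y(1) w(3) by (rule soft_cofinal)
    have "x \<le> s" "d (Suc n) \<le> s"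
      using w(1,2) s(2) by (meson order.trans wb_le)+
    then show "\<exists>x'. (soft x' \<and> (\<exists>z. soft z \<and> z \<le> e \<and> x' \<lless> z) \<and> d (Suc n) \<le> x') \<and> x \<le> x'"
      using s y by blast
  qed
  then obtain f where f: "\<And>n. soft (f n)" "\<And>n. \<exists>z. soft z \<and> z \<le> e \<and> f n \<lless> z"
    "\<And>n. d n \<le> f n" "\<And>n. f n \<le> f (Suc n)"
    by metis
  have inc: "incseq f"
    using f(4) by (rule incseq_SucI)
  then obtain s where s: "lub f s"
    using lub_ex by blast
  show ?thesis
  proof
    show "soft s"
      using inc s f(1) by (rule soft_lub)
    show "s \<le> e"
      using s by (rule lub_least) (meson f(2) order.trans wb_le)
    fix v assume v: "soft v" "v \<le> e"
    show "v \<le> s"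
    proof (rule le_by_wb)
      fix v' assume "v' \<lless> v"
      then obtain c where c: "c \<in> C" "v' \<le> c" "c \<lless> v"
        using C(2) by blast
      then have "c \<in> range d"
        unfolding d using v by (auto simp: D_def)
      then obtain n where "c = d n"
        by blast
      then show "v' \<le> s"
        using c(2) f(3)[of n] lub_upper[OF s, of n] by (auto intro: order.trans)
    qed
  qed
qed

end

theorem theorem8p5:
  fixes e :: "'a::ordered_comm_monoid_add"
  assumes "cu_semigroup (UNIV :: 'a set)"
    and "two_omega_divisible (UNIV :: 'a set)"
    and "O5 (UNIV :: 'a set)" and "O6 (UNIV :: 'a set)" and "O7 (UNIV :: 'a set)"
    and "full_in UNIV e"
  shows "(\<exists>w\<in>soft_part UNIV. w \<le> e \<and> e \<le> infty_in UNIV w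
            \<and> (\<forall>l\<in>functionals UNIV. l w = l e)
            \<and> rc UNIV e = rc (soft_part UNIV) w)
    \<and> (countably_based (UNIV :: 'a set) \<and> left_soft_separative (UNIV :: 'a set) \<longrightarrow>
         (\<exists>s\<in>soft_part UNIV. s \<le> e \<and> (\<forall>v\<in>soft_part UNIV. v \<le> e \<longrightarrow> v \<le> s)
            \<and> rc UNIV e = rc (soft_part UNIV) s))"
proof -
  interpret cu_div "wb_in (UNIV :: 'a set)" "infty_in (UNIV :: 'a set)"
    using assms(1-5) by unfold_locales auto
  have full: "x \<le> infty_in UNIV e" for x
    using assms(6) by (simp add: full_in_def)
  obtain w where w: "soft_replica w e" "e \<le> infty_in UNIV w"
    by (rule soft_replica_ex)
  have w': "soft w" "w \<le> e"
    using w(1) by (auto simp: soft_replica_def)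
  have "\<exists>s\<in>soft_part UNIV. s \<le> e \<and> (\<forall>v\<in>soft_part UNIV. v \<le> e \<longrightarrow> v \<le> s)
      \<and> rc UNIV e = rc (soft_part UNIV) s"
    if cb: "countably_based (UNIV :: 'a set)" and sep: "left_soft_separative (UNIV :: 'a set)"
  proof -
    obtain s where s: "soft s" "s \<le> e" "\<And>v. soft v \<Longrightarrow> v \<le> e \<Longrightarrow> v \<le> s"
      using largest_soft_below[OF cb sep] by blast
    have ws: "w \<le> s"
      using s(3) w' by blast
    \<comment> \<open>The error estimate for \<open>w\<close> is inherited by every soft element
      between \<open>w\<close> and \<open>e\<close>.\<close>
    have "soft_replica s e"
      unfolding soft_replica_def
    proof (intro conjI allI impI)
      fix x' k assume "wb_in UNIV x' e"
      then obtain v where v: "x' \<le> w + v" "nmul k v \<le> w + w"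
        using w(1) unfolding soft_replica_def by blast
      have "x' \<le> s + v" "nmul k v \<le> s + s"
        using v ws by (meson add_mono add_right_mono order.trans)+
      then show "\<exists>v. x' \<le> s + v \<and> nmul k v \<le> s + s"
        by blast
    qed (use s in auto)
    then have "rc UNIV e = rc (soft_part UNIV) s"
      using full by (rule rc_soft_replica)
    then show ?thesis
      using s by auto
  qed
  moreover have "rc UNIV e = rc (soft_part UNIV) w"
    using w(1) full by (rule rc_soft_replica)
  ultimately show ?thesis
    using w w' functional_soft_replica[OF w(1)] by auto
qed

end
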